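(* Let $H$ be an infinite-dimensional separable real Hilbert space, let $A\colon D(A)\subset H\to H$ be a nonnegative self-adjoint operator with compact resolvent, and let $E=D(A^{1/2})$. Let $I\in C^1(E,\mathbb{R})$ satisfy $I(0)=0$, $I'(0)=0$ and: (i) $u_k\rightharpoonup u$ weakly in $E$ implies $I(u_k)\to I(u)$; (ii) $I(u)>0$ for $u\in E\setminus\{0\}$; (iii) for every $u\in E\setminus\{0\}$ the function $t\mapsto I(tu)/t^2$ is nondecreasing on $(0,\infty)$, with limit $0$ as $t\to0^+$ and limit $+\infty$ as $t\to+\infty$; (iv) for all $u\in E\setminus\{0\}$, $v\in E$ and $s\ge-1$, $I(u)-I((1+s)u+v)+I'(u)[s(s/2+1)u+(1+s)v]\le0$, with strict inequality if $v=0$ and $s\ne0$. Let $n\ge1$ be an integer with $\lambda_n<\lambda_{n+1}$. For $\lambda\in(\lambda_n,\lambda_{n+1})$ let $Q_\lambda:=\{u\in\mathcal{NP}_\lambda: \mathcal{J}_\lambda(u)=c_\lambda\}$, and let $$M_n:=\Bigl\{\tfrac{\|u\|_H^2}{2}: u\in Q_\lambda\text{ for some }\lambda\in(\lambda_n,\lambda_{n+1})\Bigr\}.$$ Then $$(0,g_n)\subseteq M_n\subseteq(0,g_n]\qquad\text{for some }g_n>0.$$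
   Context: $E$ is a Hilbert space with scalar product $\langle u,v\rangle_E=\langle u,v\rangle_H+\langle A^{1/2}u,A^{1/2}v\rangle_H$. The eigenvalues of $A$, counted with multiplicity, are $0\le\lambda_1\le\lambda_2\le\dots\to+\infty$, and $(\zeta_k)_{k\ge1}$ is an orthonormal basis of $H$ of associated eigenfunctions, $A\zeta_k=\lambda_k\zeta_k$. For $\lambda\in\mathbb{R}$ and $u,v\in E$: $q_\lambda(u,v)=\langle A^{1/2}u,A^{1/2}v\rangle_H-\lambda\langle u,v\rangle_H$, $q_\lambda(u)=q_\lambda(u,u)$, and $\mathcal{J}_\lambda(u)=\frac12q_\lambda(u)-I(u)$. Set $E_n=\operatorname{span}\{\zeta_1,\dots,\zeta_n\}$ and, for $u\in E\setminus E_n$, $F_n(u)=E_n\oplus\mathbb{R}u$. For $\lambda\in(\lambda_n,\lambda_{n+1})$, the Nehari-Pankov set is $\mathcal{NP}_\lambda=\{u\in E\setminus E_n: \mathcal{J}_\lambda'(u)w=0\text{ for all }w\in F_n(u)\}$, and $c_\lambda=\inf_{\mathcal{NP}_\lambda}\mathcal{J}_\lambda$. *)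

theory Defs
  imports "HOL-Analysis.Analysis"
begin

text \<open>
  An unbounded operator on \<open>'h\<close> is given by its domain \<open>D\<close> together with a function \<open>A\<close> whose
  values outside \<open>D\<close> are irrelevant.
\<close>

definition densely_defined_operator :: "'h::real_inner set \<Rightarrow> ('h \<Rightarrow> 'h) \<Rightarrow> bool" where
  "densely_defined_operator D A \<longleftrightarrow>
     subspace D \<and> closure D = UNIV \<and>
     (\<forall>u\<in>D. \<forall>v\<in>D. A (u + v) = A u + A v) \<and> (\<forall>u\<in>D. \<forall>r. A (r *\<^sub>R u) = r *\<^sub>R A u)"

definition adjoint_domain :: "'h::real_inner set \<Rightarrow> ('h \<Rightarrow> 'h) \<Rightarrow> 'h set" where
  "adjoint_domain D A = {v. \<exists>w. \<forall>u\<in>D. A u \<bullet> v = u \<bullet> w}"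

definition self_adjoint_operator :: "'h::real_inner set \<Rightarrow> ('h \<Rightarrow> 'h) \<Rightarrow> bool" where
  "self_adjoint_operator D A \<longleftrightarrow>
     densely_defined_operator D A \<and> adjoint_domain D A = D \<and>
     (\<forall>u\<in>D. \<forall>v\<in>D. A u \<bullet> v = u \<bullet> A v)"

definition nonnegative_operator :: "'h::real_inner set \<Rightarrow> ('h \<Rightarrow> 'h) \<Rightarrow> bool" where
  "nonnegative_operator D A \<longleftrightarrow> (\<forall>u\<in>D. 0 \<le> A u \<bullet> u)"

definition compact_operator :: "('h::real_normed_vector \<Rightarrow> 'h) \<Rightarrow> bool" where
  "compact_operator R \<longleftrightarrow>
     bounded_linear R \<and> (\<forall>S. bounded S \<longrightarrow> compact (closure (R ` S)))"

definition is_resolvent :: "'h::real_inner set \<Rightarrow> ('h \<Rightarrow> 'h) \<Rightarrow> real \<Rightarrow> ('h \<Rightarrow> 'h) \<Rightarrow> bool" where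
  "is_resolvent D A \<mu> R \<longleftrightarrow>
     bounded_linear R \<and>
     (\<forall>x. R x \<in> D \<and> A (R x) - \<mu> *\<^sub>R R x = x) \<and> (\<forall>u\<in>D. R (A u - \<mu> *\<^sub>R u) = u)"

text \<open>By the resolvent identity, compactness at one resolvent point gives it at all of them.\<close>

definition has_compact_resolvent :: "'h::real_inner set \<Rightarrow> ('h \<Rightarrow> 'h) \<Rightarrow> bool" where
  "has_compact_resolvent D A \<longleftrightarrow> (\<exists>\<mu> R. is_resolvent D A \<mu> R \<and> compact_operator R)"

text \<open>
  \<open>(DB, B)\<close> is the square root of \<open>(D, A)\<close>: the unique nonnegative self-adjoint operator whose
  square, taken on its maximal domain, is \<open>(D, A)\<close>.
\<close>

definition is_operator_sqrt ::
    "'h::real_inner set \<Rightarrow> ('h \<Rightarrow> 'h) \<Rightarrow> 'h set \<Rightarrow> ('h \<Rightarrow> 'h) \<Rightarrow> bool" where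
  "is_operator_sqrt D A DB B \<longleftrightarrow>
     self_adjoint_operator DB B \<and> nonnegative_operator DB B \<and>
     D = {u\<in>DB. B u \<in> DB} \<and> (\<forall>u\<in>D. B (B u) = A u)"

definition eigenbasis ::
    "'h::real_inner set \<Rightarrow> ('h \<Rightarrow> 'h) \<Rightarrow> (nat \<Rightarrow> real) \<Rightarrow> (nat \<Rightarrow> 'h) \<Rightarrow> bool" where
  "eigenbasis D A ev \<zeta> \<longleftrightarrow>
     0 \<le> ev 1 \<and> mono_on {1..} ev \<and> filterlim ev at_top sequentially \<and>
     (\<forall>k\<ge>1. \<forall>l\<ge>1. \<zeta> k \<bullet> \<zeta> l = (if k = l then 1 else 0)) \<and>
     closure (span (\<zeta> ` {1..})) = UNIV \<and>
     (\<forall>k\<ge>1. \<zeta> k \<in> D \<and> A (\<zeta> k) = ev k *\<^sub>R \<zeta> k)"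

text \<open>
  The Hilbert space \<open>E = DB\<close> (with \<open>B\<close> the square root of \<open>A\<close>) carries the graph scalar product
  rather than that of \<open>'h\<close>, so it is represented by a type \<open>'e\<close> of its own. The inclusion of
  \<open>E\<close> into \<open>H\<close> is the map \<open>\<iota>\<close>; it is injective because \<open>u \<bullet> u\<close> dominates \<open>\<iota> u \<bullet> \<iota> u\<close>
  and vanishes when \<open>\<iota> u = 0\<close>. Thus the norm of \<open>u\<close> in \<open>H\<close> is \<open>norm (\<iota> u)\<close>.
\<close>

definition is_form_domain ::
    "'h::real_inner set \<Rightarrow> ('h \<Rightarrow> 'h) \<Rightarrow> ('e::real_inner \<Rightarrow> 'h) \<Rightarrow> bool" where
  "is_form_domain DB B \<iota> \<longleftrightarrow>
     linear \<iota> \<and> range \<iota> = DB \<and>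
     (\<forall>u v. u \<bullet> v = \<iota> u \<bullet> \<iota> v + B (\<iota> u) \<bullet> B (\<iota> v))"

definition weakly_converges :: "(nat \<Rightarrow> 'e::real_normed_vector) \<Rightarrow> 'e \<Rightarrow> bool" where
  "weakly_converges x u \<longleftrightarrow>
     (\<forall>f::'e \<Rightarrow> real. bounded_linear f \<longrightarrow> (\<lambda>k. f (x k)) \<longlonglongrightarrow> f u)"

definition C1_functional :: "('e::real_normed_vector \<Rightarrow> real) \<Rightarrow> bool" where
  "C1_functional I \<longleftrightarrow>
     (\<exists>I'::'e \<Rightarrow> 'e \<Rightarrow>\<^sub>L real.
        (\<forall>u. (I has_derivative blinfun_apply (I' u)) (at u)) \<and> continuous_on UNIV I')"

text \<open>Unambiguous for \<open>f\<close> differentiable at \<open>u\<close>.\<close>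

abbreviation dfun :: "('e::real_normed_vector \<Rightarrow> real) \<Rightarrow> 'e \<Rightarrow> 'e \<Rightarrow> real" where
  "dfun f u \<equiv> frechet_derivative f (at u)"

definition q_form ::
    "('h::real_inner \<Rightarrow> 'h) \<Rightarrow> ('e::real_inner \<Rightarrow> 'h) \<Rightarrow> real \<Rightarrow> 'e \<Rightarrow> 'e \<Rightarrow> real" where
  "q_form B \<iota> l u v = B (\<iota> u) \<bullet> B (\<iota> v) - l * (\<iota> u \<bullet> \<iota> v)"

definition J_fun ::
    "('h::real_inner \<Rightarrow> 'h) \<Rightarrow> ('e::real_inner \<Rightarrow> 'h) \<Rightarrow> ('e \<Rightarrow> real) \<Rightarrow> real \<Rightarrow> 'e \<Rightarrow> real" where
  "J_fun B \<iota> I l u = q_form B \<iota> l u u / 2 - I u"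

definition E_sub :: "('e::real_inner \<Rightarrow> 'h::real_inner) \<Rightarrow> (nat \<Rightarrow> 'h) \<Rightarrow> nat \<Rightarrow> 'e set" where
  "E_sub \<iota> \<zeta> n = {u. \<iota> u \<in> span (\<zeta> ` {1..n})}"

definition F_sub ::
    "('e::real_inner \<Rightarrow> 'h::real_inner) \<Rightarrow> (nat \<Rightarrow> 'h) \<Rightarrow> nat \<Rightarrow> 'e \<Rightarrow> 'e set" where
  "F_sub \<iota> \<zeta> n u = {w + t *\<^sub>R u | w t. w \<in> E_sub \<iota> \<zeta> n}"

definition NP_set ::
    "('h::real_inner \<Rightarrow> 'h) \<Rightarrow> ('e::real_inner \<Rightarrow> 'h) \<Rightarrow> ('e \<Rightarrow> real) \<Rightarrow> (nat \<Rightarrow> 'h) \<Rightarrow> nat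
      \<Rightarrow> real \<Rightarrow> 'e set" where
  "NP_set B \<iota> I \<zeta> n l =
     {u. u \<notin> E_sub \<iota> \<zeta> n \<and> (\<forall>w\<in>F_sub \<iota> \<zeta> n u. dfun (J_fun B \<iota> I l) u w = 0)}"

text \<open>
  Under the theorem's hypotheses \<open>J_fun\<close> is nonnegative on \<open>NP_set\<close>, so the real infimum is the
  true one; for an empty \<open>NP_set\<close> its value is irrelevant, \<open>Q_set\<close> being empty as well.
\<close>

definition c_level ::
    "('h::real_inner \<Rightarrow> 'h) \<Rightarrow> ('e::real_inner \<Rightarrow> 'h) \<Rightarrow> ('e \<Rightarrow> real) \<Rightarrow> (nat \<Rightarrow> 'h) \<Rightarrow> nat
      \<Rightarrow> real \<Rightarrow> real" where
  "c_level B \<iota> I \<zeta> n l = (INF u\<in>NP_set B \<iota> I \<zeta> n l. J_fun B \<iota> I l u)"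

definition Q_set ::
    "('h::real_inner \<Rightarrow> 'h) \<Rightarrow> ('e::real_inner \<Rightarrow> 'h) \<Rightarrow> ('e \<Rightarrow> real) \<Rightarrow> (nat \<Rightarrow> 'h) \<Rightarrow> nat
      \<Rightarrow> real \<Rightarrow> 'e set" where
  "Q_set B \<iota> I \<zeta> n l =
     {u\<in>NP_set B \<iota> I \<zeta> n l. J_fun B \<iota> I l u = c_level B \<iota> I \<zeta> n l}"

definition M_set ::
    "('h::real_inner \<Rightarrow> 'h) \<Rightarrow> ('e::real_inner \<Rightarrow> 'h) \<Rightarrow> ('e \<Rightarrow> real) \<Rightarrow> (nat \<Rightarrow> real)
      \<Rightarrow> (nat \<Rightarrow> 'h) \<Rightarrow> nat \<Rightarrow> real set" where
  "M_set B \<iota> I ev \<zeta> n =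
     {(norm (\<iota> u))\<^sup>2 / 2 | u l. ev n < l \<and> l < ev (n + 1) \<and> u \<in> Q_set B \<iota> I \<zeta> n l}"

end

theory Submission
  imports Defs
begin

text \<open>
  For \<open>\<lambda>\<close> between the eigenvalues \<open>a = \<lambda>\<^sub>n\<close> and \<open>b = \<lambda>\<^sub>n\<^sub>+\<^sub>1\<close>, the inequality assumed for \<open>I\<close> makes every
  Nehari--Pankov point \<open>u\<close> the strict maximum of the functional over the half-space
  \<open>E\<^sub>n \<oplus> \<real>\<^sub>\<ge>\<^sub>0 u\<close>; conversely, each half-space with a direction outside \<open>E\<^sub>n\<close> contains such a maximum.
  Thus \<open>c\<close> is a minimax level. Write \<open>mass u\<close> for half the squared \<open>H\<close>-norm and call the minimisers
  on the Nehari--Pankov set ground states. As the functional depends on \<open>\<lambda>\<close> only through the term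
  \<open>- \<lambda> mass u\<close>, the masses of the ground states govern the slopes of \<open>- c\<close>: if \<open>u\<close> is a ground state at
  \<open>\<lambda>\<close>, then \<open>c\<close> lies, on either side of \<open>\<lambda>\<close>, below a function that touches it at \<open>\<lambda>\<close> with slope
  \<open>- mass u\<close>, namely the maximum over the half-space of \<open>u\<close>.

  This one-sided information is enough. Let \<open>u0\<close> be a ground state at \<open>l0\<close> and \<open>0 < m < mass u0\<close>.
  The function \<open>c l + m l\<close> decreases immediately to the right of \<open>l0\<close>. Near \<open>b\<close> it lies below \<open>m b\<close>,
  because \<open>c l\<close> is \<open>o (b - l)\<close>: this is the same slope argument on the half-space whose direction is the
  eigenvector number \<open>n + 1\<close>, where the maximum at the parameter \<open>b\<close> sits at the origin and so has
  mass \<open>0\<close>. Since \<open>c\<close> is lower semicontinuous, \<open>c l + m l\<close> has an interior minimum,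
  and there a ground state with mass other than \<open>m\<close> would give smaller values on one side. Hence
  \<open>m\<close> is attained (\<open>smaller_mass_attained\<close>), the set of masses is an interval starting at \<open>0\<close>, and \<open>g\<close>
  is its supremum.

  What remains is compactness. Lower semicontinuity and the existence of ground states
  (\<open>c_limit_attained\<close>) come from passing to a weak limit of the directions of the half-spaces instead of
  the points themselves. Such a limit is not zero: along unit vectors tending weakly to zero, mass and
  nonlinearity disappear while the squared norm persists, so the functional would be unbounded above on
  the rays (\<open>unit_sequence_not_weak_null\<close>). The same dichotomy, together with the superquadratic
  growth of \<open>I\<close>, bounds the masses uniformly in \<open>\<lambda>\<close> (\<open>ground_state_mass_bounded\<close>).

  The argument runs in the form domain, in terms of the eigenvectors normalised there.
\<close>

section \<open>Weak convergence in a Hilbert space with an orthonormal basis\<close>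

lemma weakly_convergesD_inner:
  fixes x :: "nat \<Rightarrow> 'a::real_inner"
  assumes "weakly_converges x u"
  shows "(\<lambda>k. x k \<bullet> y) \<longlonglongrightarrow> u \<bullet> y"
  using assms bounded_linear_inner_left unfolding weakly_converges_def by blast

lemma tendsto_imp_weakly_converges: "x \<longlonglongrightarrow> u \<Longrightarrow> weakly_converges x u"
  unfolding weakly_converges_def using bounded_linear.tendsto by blast

lemma weakly_converges_scaleR:
  assumes "weakly_converges x u" shows "weakly_converges (\<lambda>k. t *\<^sub>R x k) (t *\<^sub>R u)"
  using assms unfolding weakly_converges_def
  by (auto simp: bounded_linear.linear linear_scale intro!: tendsto_mult_left)

locale orthonormal_hilbert_basis =
  fixes e :: "nat \<Rightarrow> 'a::{real_inner,banach}"
  assumes orth: "\<And>i j. e i \<bullet> e j = (if i = j then 1 else 0)"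
    and total: "\<And>x. (\<And>i. x \<bullet> e i = 0) \<Longrightarrow> x = 0"
begin

definition proj :: "nat \<Rightarrow> 'a \<Rightarrow> 'a" where
  "proj N x = (\<Sum>i<N. (x \<bullet> e i) *\<^sub>R e i)"

lemma inner_sum_basis:
  assumes "finite A" shows "(\<Sum>i\<in>A. a i *\<^sub>R e i) \<bullet> e j = (if j \<in> A then a j else 0)"
  using assms by (simp add: inner_sum_left orth if_distrib cong: if_cong)

lemma norm_sum_basis:
  assumes "finite A" shows "(norm (\<Sum>i\<in>A. a i *\<^sub>R e i))\<^sup>2 = (\<Sum>i\<in>A. (a i)\<^sup>2)"
proof -
  have "(\<Sum>i\<in>A. a i *\<^sub>R e i) \<bullet> (\<Sum>j\<in>A. a j *\<^sub>R e j) = (\<Sum>j\<in>A. a j * a j)"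
    using assms by (simp add: inner_sum_right inner_sum_basis)
  then show ?thesis unfolding power2_norm_eq_inner by (simp add: power2_eq_square)
qed

lemma proj_inner: "proj N x \<bullet> e j = (if j < N then x \<bullet> e j else 0)"
  unfolding proj_def by (simp add: inner_sum_basis)

lemma proj_inner_right: "proj N x \<bullet> y = (\<Sum>i<N. (x \<bullet> e i) * (y \<bullet> e i))"
  unfolding proj_def by (simp add: inner_sum_left) (simp add: inner_commute)

lemma linear_proj: "linear (proj N)"
  unfolding proj_def
  by (intro linearI) (simp_all add: inner_add_left scaleR_left_distrib sum.distrib scaleR_right.sum)

lemma proj_pythagoras: "(norm x)\<^sup>2 = (norm (proj N x))\<^sup>2 + (norm (x - proj N x))\<^sup>2"
proof -
  have "proj N x \<bullet> proj N x = (\<Sum>i<N. (x \<bullet> e i) * (proj N x \<bullet> e i))"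
    by (rule proj_inner_right)
  also have "\<dots> = (\<Sum>i<N. (x \<bullet> e i) * (x \<bullet> e i))"
    by (intro sum.cong) (simp_all add: proj_inner)
  also have "\<dots> = proj N x \<bullet> x" by (rule proj_inner_right[symmetric])
  finally show ?thesis
    by (simp add: power2_norm_eq_inner inner_diff inner_commute algebra_simps)
qed

lemma norm_proj_le: "norm (proj N x) \<le> norm x"
  using proj_pythagoras[of x N] by (metis le_add_same_cancel1 norm_ge_zero power2_le_imp_le zero_le_power2)

lemma norm_diff_proj_le: "norm (x - proj N x) \<le> norm x"
  using proj_pythagoras[of x N] by (metis le_add_same_cancel2 norm_ge_zero power2_le_imp_le zero_le_power2)

lemma bessel: "(\<Sum>i<N. (x \<bullet> e i)\<^sup>2) \<le> (norm x)\<^sup>2"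
proof -
  have "(\<Sum>i<N. (x \<bullet> e i)\<^sup>2) = (norm (proj N x))\<^sup>2"
    unfolding proj_def by (simp add: norm_sum_basis)
  then show ?thesis using norm_proj_le by (simp add: power_mono)
qed

text \<open>Riesz--Fischer: completeness of the space is what turns coefficients into a vector.\<close>

lemma series_tendsto:
  assumes bdd: "\<And>N. (\<Sum>i<N. (a i)\<^sup>2) \<le> C"
  obtains x where "(\<lambda>N. \<Sum>i<N. a i *\<^sub>R e i) \<longlonglongrightarrow> x" "\<And>j. x \<bullet> e j = a j"
proof -
  let ?s = "\<lambda>N. \<Sum>i<N. a i *\<^sub>R e i" and ?t = "\<lambda>N. \<Sum>i<N. (a i)\<^sup>2"
  have "convergent ?t"
  proof (rule Bseq_mono_convergent)
    show "Bseq ?t" by (rule BseqI'[of _ C]) (simp add: bdd sum_nonneg)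
    show "\<forall>M N. M \<le> N \<longrightarrow> ?t M \<le> ?t N" by (auto intro!: sum_mono2)
  qed
  then have cau: "Cauchy ?t" by (rule convergent_Cauchy)
  have diff: "(dist (?s M) (?s N))\<^sup>2 = dist (?t M) (?t N)" for M N
  proof (induction M N rule: linorder_wlog)
    case (le M N)
    have split: "sum f {..<N} = sum f {..<M} + sum f {M..<N}" for f :: "nat \<Rightarrow> 'z::comm_monoid_add"
      using le by (metis sum.atLeastLessThan_concat lessThan_atLeast0 le0)
    show ?case
      unfolding split[of "\<lambda>i. a i *\<^sub>R e i"] split[of "\<lambda>i. (a i)\<^sup>2"]
      by (simp add: dist_norm norm_sum_basis sum_nonneg)
  qed (simp add: dist_commute)
  have "Cauchy ?s"
  proof (rule metric_CauchyI)
    fix \<epsilon> :: real assume "\<epsilon> > 0"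
    then obtain M where M: "\<And>m n. m \<ge> M \<Longrightarrow> n \<ge> M \<Longrightarrow> dist (?t m) (?t n) < \<epsilon>\<^sup>2"
      using metric_CauchyD[OF cau zero_less_power[OF \<open>\<epsilon> > 0\<close>]] by blast
    have "dist (?s m) (?s n) < \<epsilon>" if "m \<ge> M" "n \<ge> M" for m n
    proof (rule power_less_imp_less_base)
      show "(dist (?s m) (?s n))\<^sup>2 < \<epsilon>\<^sup>2" unfolding diff by (rule M[OF that])
    qed (use \<open>\<epsilon> > 0\<close> in linarith)
    then show "\<exists>M. \<forall>m\<ge>M. \<forall>n\<ge>M. dist (?s m) (?s n) < \<epsilon>" by blast
  qed
  then obtain x where x: "?s \<longlonglongrightarrow> x" using Cauchy_convergent convergent_def by blast
  have "x \<bullet> e j = a j" for j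
  proof (rule LIMSEQ_unique)
    show "(\<lambda>N. ?s N \<bullet> e j) \<longlonglongrightarrow> x \<bullet> e j" by (intro tendsto_intros x)
    have "\<forall>\<^sub>F N in sequentially. ?s N \<bullet> e j = a j"
      using eventually_gt_at_top[of j] by eventually_elim (simp add: inner_sum_basis)
    then show "(\<lambda>N. ?s N \<bullet> e j) \<longlonglongrightarrow> a j" by (rule tendsto_eventually)
  qed
  with x that show ?thesis by blast
qed

lemma proj_tendsto: "(\<lambda>N. proj N x) \<longlonglongrightarrow> x"
proof -
  obtain y where y: "(\<lambda>N. proj N x) \<longlonglongrightarrow> y" "\<And>j. y \<bullet> e j = x \<bullet> e j"
    using series_tendsto[OF bessel[of x]] unfolding proj_def by metis
  have "x - y = 0" using y(2) by (intro total) (simp add: inner_diff_left)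
  then show ?thesis using y(1) by simp
qed

lemma riesz_representation:
  fixes f :: "'a \<Rightarrow> real"
  assumes f: "bounded_linear f"
  obtains g where "\<And>x. f x = x \<bullet> g"
proof -
  interpret f: bounded_linear f by (rule f)
  obtain K where K: "\<And>x. norm (f x) \<le> norm x * K" "K > 0" using f.pos_bounded by blast
  have "(\<Sum>i<N. (f (e i))\<^sup>2) \<le> K\<^sup>2" for N
  proof -
    let ?y = "\<Sum>i<N. f (e i) *\<^sub>R e i"
    have "f ?y = (norm ?y)\<^sup>2"
      by (subst norm_sum_basis) (simp_all add: f.sum f.scaleR power2_eq_square)
    then have "norm ?y * norm ?y \<le> norm ?y * K" using K(1)[of ?y] by (simp add: power2_eq_square)
    then have "norm ?y \<le> K" using K(2) by (cases "norm ?y = 0") auto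
    then have "(norm ?y)\<^sup>2 \<le> K\<^sup>2" by (intro power_mono) auto
    then show ?thesis by (simp add: norm_sum_basis)
  qed
  then obtain g where g: "\<And>j. g \<bullet> e j = f (e j)" using series_tendsto by metis
  have "f x = x \<bullet> g" for x
  proof (rule LIMSEQ_unique)
    show "(\<lambda>N. f (proj N x)) \<longlonglongrightarrow> f x" by (rule f.tendsto[OF proj_tendsto])
    have "f (proj N x) = proj N x \<bullet> g" for N
      unfolding proj_inner_right by (simp add: proj_def f.sum f.scaleR g)
    then show "(\<lambda>N. f (proj N x)) \<longlonglongrightarrow> x \<bullet> g"
      using tendsto_inner[OF proj_tendsto tendsto_const] by simp
  qed
  with that show ?thesis by blast
qed

lemma weakly_convergesI_coefficients:
  assumes bdd: "\<And>k. norm (x k) \<le> R" and coeff: "\<And>i. (\<lambda>k. x k \<bullet> e i) \<longlonglongrightarrow> u \<bullet> e i"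
  shows "weakly_converges x u"
  unfolding weakly_converges_def
proof (intro allI impI)
  fix f :: "'a \<Rightarrow> real" assume "bounded_linear f"
  then obtain g where g: "\<And>x. f x = x \<bullet> g" using riesz_representation by blast
  have R: "R \<ge> 0" using bdd[of 0] norm_ge_zero order_trans by blast
  have "(\<lambda>k. x k \<bullet> g) \<longlonglongrightarrow> u \<bullet> g"
  proof (rule LIMSEQ_I)
    fix \<epsilon> :: real assume "\<epsilon> > 0"
    define \<delta> where "\<delta> = \<epsilon> / (2 * (R + norm u + 1))"
    have \<delta>: "\<delta> > 0" using \<open>\<epsilon> > 0\<close> R by (simp add: \<delta>_def add_nonneg_pos)
    obtain N where N: "norm (g - proj N g) < \<delta>"
      using LIMSEQ_D[OF proj_tendsto[of g] \<delta>] by (metis norm_minus_commute order_refl)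
    have "(\<lambda>k. x k \<bullet> proj N g) \<longlonglongrightarrow> u \<bullet> proj N g"
      unfolding proj_def inner_sum_right inner_scaleR_right by (intro tendsto_intros coeff)
    then obtain K where K: "\<And>k. k \<ge> K \<Longrightarrow> norm (x k \<bullet> proj N g - u \<bullet> proj N g) < \<epsilon> / 2"
      using LIMSEQ_D[of _ _ "\<epsilon>/2"] \<open>\<epsilon> > 0\<close> by force
    have "norm (x k \<bullet> g - u \<bullet> g) < \<epsilon>" if "k \<ge> K" for k
    proof -
      have "\<bar>(x k - u) \<bullet> (g - proj N g)\<bar> \<le> norm (x k - u) * norm (g - proj N g)"
        by (rule Cauchy_Schwarz_ineq2)
      also have "\<dots> \<le> (R + norm u) * \<delta>"
        using bdd[of k] N norm_triangle_ineq4[of "x k" u] R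
        by (intro mult_mono) auto
      also have "\<dots> \<le> \<epsilon> / 2"
      proof -
        have "(R + norm u) * \<epsilon> \<le> (R + norm u + 1) * \<epsilon>"
          using \<open>\<epsilon> > 0\<close> by (intro mult_right_mono) auto
        moreover have "R + norm u + 1 > 0" using R by (simp add: add_nonneg_pos)
        ultimately show ?thesis by (simp add: \<delta>_def divide_simps) (simp add: algebra_simps)
      qed
      finally have 1: "\<bar>(x k - u) \<bullet> (g - proj N g)\<bar> \<le> \<epsilon> / 2" .
      have "x k \<bullet> g - u \<bullet> g = (x k - u) \<bullet> (g - proj N g) + (x k \<bullet> proj N g - u \<bullet> proj N g)"
        by (simp add: inner_diff_left inner_diff_right)
      then show ?thesis using 1 K[OF that] by (simp add: abs_if split: if_splits)
    qed
    then show "\<exists>K. \<forall>k\<ge>K. norm (x k \<bullet> g - u \<bullet> g) < \<epsilon>" by blast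
  qed
  then show "(\<lambda>k. f (x k)) \<longlonglongrightarrow> f u" by (simp add: g)
qed

text \<open>
  The coefficient sequences lie in the compact metrizable cube \<open>[-R, R]\<^sup>\<nat>\<close>, so a subsequence
  converges coefficientwise; Bessel's inequality passes to the limit.
\<close>

lemma bounded_imp_weakly_convergent_subsequence:
  fixes x :: "nat \<Rightarrow> 'a"
  assumes bdd: "\<And>k. norm (x k) \<le> R"
  obtains r u where "strict_mono r" "weakly_converges (x \<circ> r) u"
proof -
  define X where "X k = (\<lambda>i. x k \<bullet> e i)" for k
  let ?K = "PiE UNIV (\<lambda>_::nat. {-R..R}) :: (nat \<Rightarrow> real) set"
  have "norm (e i) = 1" for i by (simp add: norm_eq_sqrt_inner orth)
  then have "\<bar>x k \<bullet> e i\<bar> \<le> R" for k i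
    using Cauchy_Schwarz_ineq2[of "x k" "e i"] bdd[of k] by simp
  then have X: "\<forall>k. X k \<in> ?K" by (auto simp: X_def abs_le_iff minus_le_iff)
  have "compactin (product_topology (\<lambda>_. euclidean) UNIV) ?K"
    by (subst compactin_PiE) auto
  then have "compact ?K" by (simp add: euclidean_product_topology)
  then have "seq_compact ?K" by (rule compact_imp_seq_compact)
  then obtain a r where r: "strict_mono r" and a: "(X \<circ> r) \<longlonglongrightarrow> a"
    using X unfolding seq_compact_def by blast
  have lim: "(\<lambda>k. x (r k) \<bullet> e i) \<longlonglongrightarrow> a i" for i
    using continuous_on_tendsto_compose[OF continuous_on_product_coordinates[of i] a]
    by (simp add: X_def)
  have "(\<Sum>i<N. (a i)\<^sup>2) \<le> R\<^sup>2" for N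
  proof (rule LIMSEQ_le_const2)
    show "(\<lambda>k. \<Sum>i<N. (x (r k) \<bullet> e i)\<^sup>2) \<longlonglongrightarrow> (\<Sum>i<N. (a i)\<^sup>2)" by (intro tendsto_intros lim)
    have "(\<Sum>i<N. (x (r k) \<bullet> e i)\<^sup>2) \<le> R\<^sup>2" for k
      using order_trans[OF bessel power_mono[OF bdd norm_ge_zero]] .
    then show "\<exists>K. \<forall>k\<ge>K. (\<Sum>i<N. (x (r k) \<bullet> e i)\<^sup>2) \<le> R\<^sup>2" by blast
  qed
  then obtain u where u: "\<And>i. u \<bullet> e i = a i" using series_tendsto by metis
  have "weakly_converges (x \<circ> r) u"
    by (rule weakly_convergesI_coefficients[of _ R]) (use bdd lim u in auto)
  with r that show ?thesis by blast
qed

end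

section \<open>A compactly embedded form domain\<close>

text \<open>
  The vectors \<open>e i\<close> are the eigenvectors normalised in the form domain, and \<open>ev\<close> lists the
  eigenvalues. In \<open>H\<close>, the squared length of \<open>\<iota> (e i)\<close> is therefore \<open>1 / (1 + ev i)\<close>.
\<close>

locale compact_form = orthonormal_hilbert_basis e
  for e :: "nat \<Rightarrow> 'e::{real_inner,banach}" +
  fixes \<iota> :: "'e \<Rightarrow> 'h::real_inner" and ev :: "nat \<Rightarrow> real"
  assumes bl: "bounded_linear \<iota>"
    and eig: "\<And>x i. \<iota> x \<bullet> \<iota> (e i) = (x \<bullet> e i) / (1 + ev i)"
    and ev_nonneg: "\<And>i. 0 \<le> ev i"
    and ev_top: "filterlim ev at_top sequentially"
begin

definition mass :: "'e \<Rightarrow> real" where "mass x = (norm (\<iota> x))\<^sup>2 / 2"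

lemma mass_eq: "mass x = (\<iota> x \<bullet> \<iota> x) / 2"
  by (simp add: mass_def power2_norm_eq_inner)

lemma mass_nonneg: "mass x \<ge> 0" by (simp add: mass_def)

lemma mass_scaleR: "mass (t *\<^sub>R x) = t\<^sup>2 * mass x"
  by (simp add: mass_def bounded_linear.linear[OF bl] linear_scale power_mult_distrib)

lemma mass_tendsto: "x \<longlonglongrightarrow> u \<Longrightarrow> (\<lambda>k. mass (x k)) \<longlonglongrightarrow> mass u"
  unfolding mass_def by (intro tendsto_intros bounded_linear.tendsto[OF bl]) auto

text \<open>The basis is orthogonal for the scalar product of \<open>H\<close>, too, so both forms are diagonal in it.\<close>

lemma mass_proj: "2 * mass (proj N x) = (\<Sum>i<N. (x \<bullet> e i)\<^sup>2 / (1 + ev i))"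
proof -
  have "\<iota> (proj N x) = (\<Sum>i<N. (x \<bullet> e i) *\<^sub>R \<iota> (e i))"
    using bounded_linear.linear[OF bl] by (simp add: proj_def linear_sum linear_scale)
  then have "\<iota> (proj N x) \<bullet> \<iota> (proj N x) = (\<Sum>i<N. (x \<bullet> e i) * (\<iota> (proj N x) \<bullet> \<iota> (e i)))"
    by (metis (no_types, lifting) inner_scaleR_right inner_sum_right sum.cong)
  also have "\<dots> = (\<Sum>i<N. (x \<bullet> e i)\<^sup>2 / (1 + ev i))"
    by (intro sum.cong) (simp_all add: eig proj_inner power2_eq_square)
  finally show ?thesis by (simp add: mass_eq)
qed

lemma mass_high_le:
  assumes "\<And>i. i < M \<Longrightarrow> x \<bullet> e i = 0" and "\<And>i. i \<ge> M \<Longrightarrow> L \<le> ev i" and "L > -1"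
  shows "(1 + L) * (2 * mass x) \<le> (norm x)\<^sup>2"
proof (rule LIMSEQ_le_const2)
  show "(\<lambda>N. (1 + L) * (2 * mass (proj N x))) \<longlonglongrightarrow> (1 + L) * (2 * mass x)"
    by (intro tendsto_intros mass_tendsto proj_tendsto)
  have "(1 + L) * (2 * mass (proj N x)) \<le> (norm x)\<^sup>2" for N
  proof -
    have "(1 + L) * ((x \<bullet> e i)\<^sup>2 / (1 + ev i)) \<le> (x \<bullet> e i)\<^sup>2" for i
    proof (cases "i < M")
      case False
      then have "1 + L \<le> 1 + ev i" using assms(2) by simp
      then have "(1 + L) * (x \<bullet> e i)\<^sup>2 \<le> (1 + ev i) * (x \<bullet> e i)\<^sup>2" by (intro mult_right_mono) auto
      then show ?thesis using ev_nonneg[of i] by (simp add: divide_le_eq algebra_simps)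
    qed (use assms(1) in simp)
    then have "(1 + L) * (2 * mass (proj N x)) \<le> (\<Sum>i<N. (x \<bullet> e i)\<^sup>2)"
      unfolding mass_proj sum_distrib_left by (intro sum_mono)
    then show ?thesis using bessel[of x N] by linarith
  qed
  then show "\<exists>K. \<forall>N\<ge>K. (1 + L) * (2 * mass (proj N x)) \<le> (norm x)\<^sup>2" by blast
qed

lemma mass_low_ge:
  assumes "proj N x = x" and "\<And>i. i < N \<Longrightarrow> ev i \<le> L"
  shows "(norm x)\<^sup>2 \<le> (1 + L) * (2 * mass x)"
proof -
  have "(x \<bullet> e i)\<^sup>2 \<le> (1 + L) * ((x \<bullet> e i)\<^sup>2 / (1 + ev i))" if "i < N" for i
  proof -
    have "(1 + ev i) * (x \<bullet> e i)\<^sup>2 \<le> (1 + L) * (x \<bullet> e i)\<^sup>2"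
      using assms(2)[OF that] by (intro mult_right_mono) auto
    then show ?thesis using ev_nonneg[of i] by (simp add: le_divide_eq algebra_simps)
  qed
  then have "(\<Sum>i<N. (x \<bullet> e i)\<^sup>2) \<le> (1 + L) * (2 * mass (proj N x))"
    unfolding mass_proj sum_distrib_left by (intro sum_mono) auto
  moreover have "(\<Sum>i<N. (x \<bullet> e i)\<^sup>2) = (norm (proj N x))\<^sup>2"
    unfolding proj_def by (simp add: norm_sum_basis)
  ultimately show ?thesis using assms(1) by simp
qed

text \<open>
  Compactness of the embedding, as the eigenvalues tend to infinity: finitely many coefficients
  converge, and the mass of the remaining ones is uniformly small.
\<close>

lemma weak_null_imp_mass_null:
  assumes bdd: "\<And>k. norm (x k) \<le> R" and weak: "weakly_converges x 0"
  shows "(\<lambda>k. \<iota> (x k)) \<longlonglongrightarrow> 0"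
proof (rule LIMSEQ_I)
  interpret \<iota>: bounded_linear \<iota> by (rule bl)
  fix \<epsilon> :: real assume \<epsilon>: "\<epsilon> > 0"
  define L where "L = (2 * R / \<epsilon>)\<^sup>2"
  have L: "L \<ge> 0" by (simp add: L_def)
  obtain N where N: "\<And>i. i \<ge> N \<Longrightarrow> L \<le> ev i"
    using ev_top unfolding filterlim_at_top eventually_sequentially by blast
  have "(\<lambda>k. \<iota> (proj N (x k))) \<longlonglongrightarrow> \<iota> (\<Sum>i<N. (0 \<bullet> e i) *\<^sub>R e i)"
    unfolding proj_def by (intro \<iota>.tendsto tendsto_intros weakly_convergesD_inner weak)
  then have "(\<lambda>k. \<iota> (proj N (x k))) \<longlonglongrightarrow> 0" by (simp add: \<iota>.zero)
  then obtain K where K: "\<And>k. k \<ge> K \<Longrightarrow> norm (\<iota> (proj N (x k))) < \<epsilon> / 2"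
    using LIMSEQ_D[of _ 0 "\<epsilon>/2"] \<epsilon> by force
  have "norm (\<iota> (x k) - 0) < \<epsilon>" if "k \<ge> K" for k
  proof -
    let ?y = "x k - proj N (x k)"
    have "(1 + L) * (norm (\<iota> ?y))\<^sup>2 \<le> R\<^sup>2"
    proof -
      have "(1 + L) * (2 * mass ?y) \<le> (norm ?y)\<^sup>2"
        by (rule mass_high_le[of N]) (use N L in \<open>auto simp: inner_diff_left proj_inner\<close>)
      also have "\<dots> \<le> R\<^sup>2"
        using norm_diff_proj_le[of "x k" N] bdd[of k] by (intro power_mono) auto
      finally show ?thesis by (simp add: mass_def)
    qed
    also have "R\<^sup>2 = L * (\<epsilon> / 2)\<^sup>2" using \<epsilon> by (simp add: L_def power2_eq_square field_simps)
    also have "\<dots> \<le> (1 + L) * (\<epsilon> / 2)\<^sup>2" by (intro mult_right_mono) auto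
    finally have "(norm (\<iota> ?y))\<^sup>2 \<le> (\<epsilon> / 2)\<^sup>2" using L by simp
    then have "norm (\<iota> ?y) \<le> \<epsilon> / 2" using \<epsilon> power2_le_imp_le by (metis half_gt_zero less_imp_le)
    then show ?thesis using K[OF that] norm_triangle_ineq[of "\<iota> (proj N (x k))" "\<iota> ?y"]
      by (simp add: \<iota>.diff)
  qed
  then show "\<exists>K. \<forall>k\<ge>K. norm (\<iota> (x k) - 0) < \<epsilon>" by blast
qed

lemma weak_imp_mass_tendsto:
  assumes bdd: "\<And>k. norm (x k) \<le> R" and weak: "weakly_converges x u"
  shows "(\<lambda>k. mass (x k)) \<longlonglongrightarrow> mass u"
proof -
  interpret \<iota>: bounded_linear \<iota> by (rule bl)
  have "norm (x k - u) \<le> R + norm u" for k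
    using bdd[of k] norm_triangle_ineq4[of "x k" u] by linarith
  moreover have "weakly_converges (\<lambda>k. x k - u) 0"
    using weak unfolding weakly_converges_def
    by (auto simp: bounded_linear.linear linear_diff linear_0 intro!: tendsto_eq_intros)
  ultimately have "(\<lambda>k. \<iota> (x k - u)) \<longlonglongrightarrow> 0" by (rule weak_null_imp_mass_null)
  then have "(\<lambda>k. \<iota> (x k)) \<longlonglongrightarrow> \<iota> u" by (simp add: \<iota>.diff LIM_zero_iff)
  then show ?thesis unfolding mass_def by (intro tendsto_intros) auto
qed

end

section \<open>The half-spaces on which the functional is maximised\<close>

text \<open>
  Indices start at \<open>0\<close>, so \<open>e 0, \<dots>, e (n - 1)\<close> span \<open>E\<^sub>n\<close>, the number \<open>a\<close> is \<open>\<lambda>\<^sub>n\<close>, and \<open>b = ev n\<close> is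
  \<open>\<lambda>\<^sub>n\<^sub>+\<^sub>1\<close>.
\<close>

locale nehari_pankov = compact_form e \<iota> ev
  for e :: "nat \<Rightarrow> 'e::{real_inner,banach}" and \<iota> :: "'e \<Rightarrow> 'h::real_inner" and ev +
  fixes I :: "'e \<Rightarrow> real" and n :: nat and a b :: real
  assumes I_diff: "\<And>u. I differentiable (at u)"
    and I_zero: "I 0 = 0"
    and I_weak: "\<And>x u. weakly_converges x u \<Longrightarrow> (\<lambda>k. I (x k)) \<longlonglongrightarrow> I u"
    and I_pos: "\<And>u. u \<noteq> 0 \<Longrightarrow> 0 < I u"
    and I_mono: "\<And>u. u \<noteq> 0 \<Longrightarrow> mono_on {0<..} (\<lambda>t. I (t *\<^sub>R u) / t\<^sup>2)"
    and I_at_0: "\<And>u. u \<noteq> 0 \<Longrightarrow> ((\<lambda>t. I (t *\<^sub>R u) / t\<^sup>2) \<longlongrightarrow> 0) (at_right 0)"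
    and I_at_top: "\<And>u. u \<noteq> 0 \<Longrightarrow> filterlim (\<lambda>t. I (t *\<^sub>R u) / t\<^sup>2) at_top at_top"
    and I_ineq: "\<And>u v s. u \<noteq> 0 \<Longrightarrow> s \<ge> -1 \<Longrightarrow>
        I u - I ((1 + s) *\<^sub>R u + v) + dfun I u ((s * (s / 2 + 1)) *\<^sub>R u + (1 + s) *\<^sub>R v) \<le> 0"
    and I_ineq_strict: "\<And>u s. u \<noteq> 0 \<Longrightarrow> s \<ge> -1 \<Longrightarrow> s \<noteq> 0 \<Longrightarrow>
        I u - I ((1 + s) *\<^sub>R u) + dfun I u ((s * (s / 2 + 1)) *\<^sub>R u) < 0"
    and ev_low: "\<And>i. i < n \<Longrightarrow> ev i \<le> a"
    and ev_high: "\<And>i. n \<le> i \<Longrightarrow> b \<le> ev i"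
    and ev_n: "ev n = b"
    and a_nonneg: "0 \<le> a"
    and a_less_b: "a < b"
begin

text \<open>
  Since \<open>x \<bullet> y\<close> is the graph scalar product, this is \<open>\<langle>A\<^sup>1\<^sup>/\<^sup>2 x, A\<^sup>1\<^sup>/\<^sup>2 y\<rangle> - l \<langle>x, y\<rangle>\<close>, both products taken
  in \<open>H\<close>.
\<close>

definition q :: "real \<Rightarrow> 'e \<Rightarrow> 'e \<Rightarrow> real" where
  "q l x y = x \<bullet> y - (1 + l) * (\<iota> x \<bullet> \<iota> y)"

definition J :: "real \<Rightarrow> 'e \<Rightarrow> real" where
  "J l x = q l x x / 2 - I x"

definition V :: "'e set" where "V = span (e ` {..<n})"

definition unit_perp :: "'e \<Rightarrow> bool" where
  "unit_perp w \<longleftrightarrow> norm w = 1 \<and> (\<forall>i<n. w \<bullet> e i = 0)"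

definition halfspace :: "'e \<Rightarrow> 'e set" where
  "halfspace w = {v + t *\<^sub>R w | v t. v \<in> V \<and> 0 \<le> t}"

definition NP :: "real \<Rightarrow> 'e set" where
  "NP l = {u. u \<notin> V \<and> (\<forall>w\<in>{v + t *\<^sub>R u | v t. v \<in> V}. dfun (J l) u w = 0)}"

definition c :: "real \<Rightarrow> real" where "c l = (INF u\<in>NP l. J l u)"

sublocale \<iota>: bounded_linear \<iota> by (rule bl)

lemma subspace_V: "subspace V" by (simp add: V_def)

lemma proj_in_V: "proj n x \<in> V"
  unfolding proj_def V_def by (intro span_sum span_scale span_base) auto

lemma V_iff: "v \<in> V \<longleftrightarrow> proj n v = v"
proof
  have "subspace {v. proj n v = v}"
    using linear_proj[of n] by (auto simp: subspace_def linear_0 linear_add linear_scale)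
  moreover have "proj n (e i) = e i" if "i < n" for i
  proof -
    have "proj n (e i) = (\<Sum>j<n. if j = i then e i else 0)"
      unfolding proj_def by (intro sum.cong) (auto simp: orth)
    then show ?thesis using that by simp
  qed
  ultimately have "span (e ` {..<n}) \<subseteq> {v. proj n v = v}" by (intro span_minimal) auto
  then show "proj n v = v" if "v \<in> V" using that by (auto simp: V_def)
next
  show "v \<in> V" if "proj n v = v" using that proj_in_V[of v] by simp
qed

lemma V_perp:
  assumes "v \<in> V" and perp: "\<And>i. i < n \<Longrightarrow> x \<bullet> e i = 0"
  shows "v \<bullet> x = 0"
  using assms V_iff[of v] proj_inner_right[of n v x] by simp

lemma V_perp_high:
  assumes "v \<in> V" "n \<le> i" shows "v \<bullet> e i = 0"
  using assms V_iff[of v] proj_inner[of n v i] by simp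

lemma q_sym: "q l x y = q l y x"
  by (simp add: q_def inner_commute)

lemma q_add_right: "q l x (y + z) = q l x y + q l x z"
  by (simp add: q_def \<iota>.add inner_add_right algebra_simps)

lemma q_scaleR_right: "q l x (t *\<^sub>R y) = t * q l x y"
  by (simp add: q_def \<iota>.scaleR algebra_simps)

lemma q_line: "q l (v + t *\<^sub>R u) (v + t *\<^sub>R u) = q l v v + 2 * t * q l u v + t\<^sup>2 * q l u u"
proof -
  have "q l (v + t *\<^sub>R u) (v + t *\<^sub>R u) = q l (v + t *\<^sub>R u) v + t * q l (v + t *\<^sub>R u) u"
    by (simp add: q_add_right q_scaleR_right)
  also have "\<dots> = q l v (v + t *\<^sub>R u) + t * q l u (v + t *\<^sub>R u)" by (simp add: q_sym)
  finally show ?thesis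
    by (simp add: q_add_right q_scaleR_right q_sym power2_eq_square algebra_simps)
qed

lemma q_mass: "q l x x = (norm x)\<^sup>2 - (1 + l) * (2 * mass x)"
  by (simp add: q_def mass_eq power2_norm_eq_inner)

lemma J_mass: "J l x = (norm x)\<^sup>2 / 2 - (1 + l) * mass x - I x"
  by (simp add: J_def q_mass diff_divide_distrib)

lemma J_shift: "J l' x = J l x + (l - l') * mass x"
  by (simp add: J_mass algebra_simps)

lemma I_nonneg: "0 \<le> I x"
  using I_pos[of x] I_zero by (cases "x = 0") auto

lemma J_zero: "J l 0 = 0"
  by (simp add: J_mass I_zero mass_def \<iota>.zero)

lemma J_le_norm: "0 \<le> l \<Longrightarrow> J l x \<le> (norm x)\<^sup>2 / 2"
  using I_nonneg[of x] mult_nonneg_nonneg[OF _ mass_nonneg[of x], of "1 + l"]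
  unfolding J_mass by linarith

lemma mass_pos: assumes "x \<noteq> 0" shows "0 < mass x"
proof (rule ccontr)
  assume "\<not> 0 < mass x"
  then have "\<iota> x = 0" by (simp add: mass_def)
  then have "x \<bullet> e i = 0" for i
    using eig[of x i] ev_nonneg[of i] by (simp add: add_nonneg_eq_0_iff)
  then show False using total assms by blast
qed

lemma q_neg_on_V:
  assumes "v \<in> V" "v \<noteq> 0" "a < l" shows "q l v v < 0"
proof -
  have "(norm v)\<^sup>2 \<le> (1 + a) * (2 * mass v)"
    using mass_low_ge[of n v a] assms(1) ev_low V_iff by blast
  also have "\<dots> < (1 + l) * (2 * mass v)"
    using assms mass_pos[of v] by (intro mult_strict_right_mono) auto
  finally show ?thesis by (simp add: q_mass)
qed

lemma q_pos_on_perp: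
  assumes "unit_perp w" "l < b" shows "0 < q l w w"
proof -
  have w: "w \<noteq> 0" using assms(1) by (auto simp: unit_perp_def)
  have "(1 + l) * (2 * mass w) < (1 + b) * (2 * mass w)"
    using assms mass_pos[OF w] by (intro mult_strict_right_mono) auto
  also have "\<dots> \<le> (norm w)\<^sup>2"
    using assms a_nonneg a_less_b ev_high by (intro mass_high_le[of n]) (auto simp: unit_perp_def)
  finally show ?thesis by (simp add: q_mass)
qed

lemma unit_perp_e: "unit_perp (e n)"
  by (auto simp: unit_perp_def norm_eq_sqrt_inner orth)

lemma halfspace_iff:
  assumes "unit_perp w"
  shows "x \<in> halfspace w \<longleftrightarrow> x = proj n x + (x \<bullet> w) *\<^sub>R w \<and> 0 \<le> x \<bullet> w"
proof
  assume "x \<in> halfspace w"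
  then obtain v t where x: "x = v + t *\<^sub>R w" and v: "v \<in> V" and t: "0 \<le> t"
    unfolding halfspace_def by blast
  have "v \<bullet> w = 0" by (rule V_perp[OF v]) (use assms in \<open>simp add: unit_perp_def\<close>)
  then have xw: "x \<bullet> w = t"
    using assms by (simp add: x inner_add_left unit_perp_def norm_eq_1)
  have "proj n w = 0" using assms by (simp add: proj_def unit_perp_def)
  then have "proj n x = v"
    using v by (simp add: x linear_proj linear_add linear_scale V_iff)
  then show "x = proj n x + (x \<bullet> w) *\<^sub>R w \<and> 0 \<le> x \<bullet> w" using xw x t by simp
next
  assume "x = proj n x + (x \<bullet> w) *\<^sub>R w \<and> 0 \<le> x \<bullet> w"
  then show "x \<in> halfspace w" unfolding halfspace_def using proj_in_V by blast
qed

lemma halfspaceI: "v \<in> V \<Longrightarrow> 0 \<le> t \<Longrightarrow> v + t *\<^sub>R w \<in> halfspace w"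
  unfolding halfspace_def by blast

lemma zero_in_halfspace: "0 \<in> halfspace w"
  using halfspaceI[of 0 0 w] subspace_V by (simp add: subspace_0)

lemma halfspace_scaleR:
  assumes "x \<in> halfspace w" "0 \<le> s" shows "s *\<^sub>R x \<in> halfspace w"
proof -
  obtain v t where x: "x = v + t *\<^sub>R w" "v \<in> V" "0 \<le> t"
    using assms(1) unfolding halfspace_def by blast
  have "s *\<^sub>R x = s *\<^sub>R v + (s * t) *\<^sub>R w" by (simp add: x scaleR_add_right)
  then show ?thesis using x assms(2) subspace_V by (simp add: halfspaceI subspace_scale)
qed

text \<open>A half-space has finitely many coordinates, so weak limits in it are limits in norm.\<close>

lemma halfspace_weak_imp_strong:
  assumes w: "unit_perp w" and x: "\<And>k. x k \<in> halfspace w" and weak: "weakly_converges x u"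
  shows "x \<longlonglongrightarrow> u" "u \<in> halfspace w"
proof -
  note lim = weakly_convergesD_inner[OF weak]
  define y where "y = proj n u + (u \<bullet> w) *\<^sub>R w"
  have eq: "x k = proj n (x k) + (x k \<bullet> w) *\<^sub>R w" and ge: "0 \<le> x k \<bullet> w" for k
    using x[of k] halfspace_iff[OF w] by blast+
  have "(\<lambda>k. proj n (x k) + (x k \<bullet> w) *\<^sub>R w) \<longlonglongrightarrow> y"
    unfolding y_def proj_def by (intro tendsto_intros lim)
  then have y: "x \<longlonglongrightarrow> y" using eq by simp
  have "u \<bullet> e i = y \<bullet> e i" for i
    using LIMSEQ_unique[OF lim tendsto_inner[OF y tendsto_const]] .
  then have "u - y = 0" by (intro total) (simp add: inner_diff_left)
  then have uy: "u = y" by simp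
  then show "x \<longlonglongrightarrow> u" using y by simp
  have "0 \<le> u \<bullet> w" using LIMSEQ_le_const[OF lim, of 0 w] ge by blast
  then show "u \<in> halfspace w" using halfspace_iff[OF w] uy[unfolded y_def] by blast
qed

section \<open>Compactness\<close>

text \<open>
  Only the squared norm is not weakly continuous, and it occurs with a positive sign; it is bounded
  below by its tangent at the limit.
\<close>

lemma weakly_lower_semicontinuous:
  assumes weak: "weakly_converges x u" and bdd: "\<And>k. norm (x k) \<le> R"
    and l: "l \<longlonglongrightarrow> L" and C: "C \<longlonglongrightarrow> C0" and le: "\<And>k. J (l k) (x k) \<le> C k"
  shows "J L u \<le> C0"
proof -
  have "(2 * (x k \<bullet> u) - u \<bullet> u) / 2 - (1 + l k) * mass (x k) - I (x k) \<le> C k" for k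
  proof -
    have "0 \<le> (x k - u) \<bullet> (x k - u)" by simp
    then have "(2 * (x k \<bullet> u) - u \<bullet> u) / 2 \<le> (norm (x k))\<^sup>2 / 2"
      by (simp add: inner_diff inner_commute power2_norm_eq_inner algebra_simps)
    then show ?thesis using le[of k] unfolding J_mass by linarith
  qed
  moreover have "(\<lambda>k. (2 * (x k \<bullet> u) - u \<bullet> u) / 2 - (1 + l k) * mass (x k) - I (x k))
      \<longlonglongrightarrow> (2 * (u \<bullet> u) - u \<bullet> u) / 2 - (1 + L) * mass u - I u"
    by (intro tendsto_intros weakly_convergesD_inner[OF weak] l
        weak_imp_mass_tendsto[OF bdd weak] I_weak[OF weak]) simp
  ultimately have "(2 * (u \<bullet> u) - u \<bullet> u) / 2 - (1 + L) * mass u - I u \<le> C0"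
    using LIMSEQ_le[OF _ C] by blast
  then show ?thesis by (simp add: J_mass power2_norm_eq_inner)
qed

lemma J_tendsto:
  assumes "x \<longlonglongrightarrow> u" "l \<longlonglongrightarrow> L" shows "(\<lambda>k. J (l k) (x k)) \<longlonglongrightarrow> J L u"
  unfolding J_mass
  by (intro tendsto_intros assms mass_tendsto I_weak tendsto_imp_weakly_converges) auto

text \<open>
  Monotonicity of the quotient turns growth along the fixed ray of the weak limit into growth
  along rays that vary.
\<close>

lemma superquadratic:
  assumes weak: "weakly_converges z z0" and z0: "z0 \<noteq> 0" and z: "\<And>k. z k \<noteq> 0"
    and r: "filterlim r at_top sequentially"
  shows "\<forall>\<^sub>F k in sequentially. M * (r k)\<^sup>2 \<le> I (r k *\<^sub>R z k)"
proof -
  have "\<forall>\<^sub>F t in at_top. M < I (t *\<^sub>R z0) / t\<^sup>2 \<and> 0 < t"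
    using I_at_top[OF z0] by (intro eventually_conj eventually_gt_at_top) (simp add: filterlim_at_top_dense)
  then obtain T where T: "M < I (T *\<^sub>R z0) / T\<^sup>2" "0 < T"
    by (metis (no_types, lifting) eventually_at_top_linorder order_refl)
  have "(\<lambda>k. I (T *\<^sub>R z k) / T\<^sup>2) \<longlonglongrightarrow> I (T *\<^sub>R z0) / T\<^sup>2"
    using T(2) by (intro tendsto_intros I_weak weakly_converges_scaleR weak) auto
  then have "\<forall>\<^sub>F k in sequentially. M < I (T *\<^sub>R z k) / T\<^sup>2" using T(1) order_tendstoD(1) by blast
  moreover have "\<forall>\<^sub>F k in sequentially. T \<le> r k" using r by (simp add: filterlim_at_top)
  ultimately show ?thesis
  proof eventually_elim
    case (elim k)
    have "I (T *\<^sub>R z k) / T\<^sup>2 \<le> I (r k *\<^sub>R z k) / (r k)\<^sup>2"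
      using mono_onD[OF I_mono[OF z[of k]], of T "r k"] elim T(2) by simp
    then have "M \<le> I (r k *\<^sub>R z k) / (r k)\<^sup>2" using elim by linarith
    then show ?case using elim T(2) by (simp add: le_divide_eq split: if_splits)
  qed
qed

text \<open>
  If the directions had a weak limit other than zero, \<open>I\<close> would outgrow the quadratic part, and \<open>J\<close> would
  tend to \<open>-\<infinity>\<close>.
\<close>

lemma escaping_direction_weak_null:
  assumes low: "\<And>k. - C \<le> J (l k) (x k)" and l: "\<And>k. 0 \<le> l k"
    and x: "\<And>k. real k < norm (x k)"
    and weak: "weakly_converges (\<lambda>k. inverse (norm (x k)) *\<^sub>R x k) z"
  shows "z = 0"
proof (rule ccontr)
  assume z: "z \<noteq> 0"
  have x0: "x k \<noteq> 0" for k using x[of k] by auto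
  have r: "filterlim (\<lambda>k. norm (x k)) at_top sequentially"
    by (rule filterlim_at_top_mono[OF filterlim_real_sequentially]) (simp add: x less_imp_le)
  have "\<forall>\<^sub>F k in sequentially.
      (1 + \<bar>C\<bar>) * (norm (x k))\<^sup>2 \<le> I (norm (x k) *\<^sub>R inverse (norm (x k)) *\<^sub>R x k)"
    using x0 by (intro superquadratic[OF weak z _ r]) auto
  moreover have "\<forall>\<^sub>F k in sequentially. 1 \<le> norm (x k)" using r by (simp add: filterlim_at_top)
  ultimately have "\<forall>\<^sub>F k in sequentially. False"
  proof eventually_elim
    case (elim k)
    have 1: "1 \<le> (norm (x k))\<^sup>2" using elim(2) by simp
    then have "\<bar>C\<bar> * 1 \<le> \<bar>C\<bar> * (norm (x k))\<^sup>2" by (intro mult_left_mono) auto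
    moreover have "(1 + \<bar>C\<bar>) * (norm (x k))\<^sup>2 \<le> I (x k)" using elim(1) x0 by simp
    moreover have "0 \<le> (1 + l k) * mass (x k)" using l mass_nonneg by simp
    ultimately show ?case using low[of k] 1 by (simp add: J_mass algebra_simps abs_if split: if_splits)
  qed
  then show False by simp
qed

text \<open>
  Directions in a half-space have limits of norm \<open>1\<close>, so an unbounded sequence in it falls under the
  alternative excluded above.
\<close>

lemma halfspace_coercive:
  assumes w: "unit_perp w"
  obtains R where "\<And>x l. x \<in> halfspace w \<Longrightarrow> 0 \<le> l \<Longrightarrow> - C \<le> J l x \<Longrightarrow> norm x \<le> R"
proof (rule ccontr)
  assume "\<not> thesis"
  then have "\<exists>x l. x \<in> halfspace w \<and> 0 \<le> l \<and> - C \<le> J l x \<and> real k < norm x" for k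
    using that[of "real k"] by force
  then obtain x l where x: "\<And>k. x k \<in> halfspace w" and l: "\<And>k. 0 \<le> l k"
    and low: "\<And>k. - C \<le> J (l k) (x k)" and big: "\<And>k. real k < norm (x k)" by metis
  define z where "z k = inverse (norm (x k)) *\<^sub>R x k" for k
  have nz: "norm (z k) = 1" for k
  proof -
    have "x k \<noteq> 0" using big[of k] by auto
    then show ?thesis by (simp add: z_def)
  qed
  then obtain r z0 where r: "strict_mono r" and weak: "weakly_converges (z \<circ> r) z0"
    using bounded_imp_weakly_convergent_subsequence[of z 1] by auto
  have zin: "(z \<circ> r) k \<in> halfspace w" for k using halfspace_scaleR[OF x] by (simp add: z_def)
  have "z0 = 0"
  proof (rule escaping_direction_weak_null)
    show "weakly_converges (\<lambda>k. inverse (norm ((x \<circ> r) k)) *\<^sub>R (x \<circ> r) k) z0"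
      using weak by (simp add: z_def o_def)
    show "real k < norm ((x \<circ> r) k)" for k
      using big[of "r k"] seq_suble[OF r, of k] by (simp add: order_le_less_trans)
    show "- C \<le> J ((l \<circ> r) k) ((x \<circ> r) k)" "0 \<le> (l \<circ> r) k" for k using low l by simp_all
  qed
  moreover have "(\<lambda>k. norm ((z \<circ> r) k)) \<longlonglongrightarrow> norm z0"
    by (intro tendsto_norm halfspace_weak_imp_strong[OF w zin weak])
  then have "norm z0 = 1" using nz by (simp add: LIMSEQ_const_iff)
  ultimately show False by simp
qed

lemma halfspace_maximizing_subsequence:
  assumes w: "unit_perp w" and x: "\<And>k. x k \<in> halfspace w"
    and l: "\<And>k. 0 \<le> l k" "l \<longlonglongrightarrow> L" and d: "\<And>k. d k \<le> J (l k) (x k)" "d \<longlonglongrightarrow> D"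
  obtains r u where "strict_mono r" "u \<in> halfspace w" "(x \<circ> r) \<longlonglongrightarrow> u" "D \<le> J L u"
proof -
  obtain C where C: "\<And>k. norm (d k) \<le> C"
    using convergent_imp_Bseq[OF convergentI[OF d(2)]] unfolding Bseq_def by blast
  obtain R where R: "\<And>x l. x \<in> halfspace w \<Longrightarrow> 0 \<le> l \<Longrightarrow> - C \<le> J l x \<Longrightarrow> norm x \<le> R"
    using halfspace_coercive[OF w] by blast
  have "- C \<le> J (l k) (x k)" for k using C[of k] d(1)[of k] by (simp add: abs_le_iff)
  then have "norm (x k) \<le> R" for k using R x l by blast
  then obtain r u where r: "strict_mono r" and weak: "weakly_converges (x \<circ> r) u"
    using bounded_imp_weakly_convergent_subsequence by blast
  have xr: "(x \<circ> r) k \<in> halfspace w" for k using x by simp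
  have "(\<lambda>k. J ((l \<circ> r) k) ((x \<circ> r) k)) \<longlonglongrightarrow> J L u"
    by (intro J_tendsto halfspace_weak_imp_strong[OF w xr weak] LIMSEQ_subseq_LIMSEQ l r)
  then have "D \<le> J L u"
    using LIMSEQ_le[OF LIMSEQ_subseq_LIMSEQ[OF d(2) r]] d(1) by auto
  then show ?thesis using that[OF r] halfspace_weak_imp_strong[OF w xr weak] by blast
qed

lemma maximizer_exists:
  assumes w: "unit_perp w" and l: "0 \<le> l"
  obtains y where "y \<in> halfspace w" "\<And>x. x \<in> halfspace w \<Longrightarrow> J l x \<le> J l y"
proof -
  obtain R where R: "\<And>x l. x \<in> halfspace w \<Longrightarrow> 0 \<le> l \<Longrightarrow> - 0 \<le> J l x \<Longrightarrow> norm x \<le> R"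
    using halfspace_coercive[OF w] by blast
  have le: "J l x \<le> R\<^sup>2 / 2" if "x \<in> halfspace w" for x
  proof (cases "0 \<le> J l x")
    case True
    then have "(norm x)\<^sup>2 \<le> R\<^sup>2" using R[OF that l] by (intro power_mono) auto
    then show ?thesis using J_le_norm[OF l, of x] by simp
  next
    case False
    then show ?thesis using zero_le_power2[of R] by linarith
  qed
  then have bdd: "bdd_above (J l ` halfspace w)" by (intro bdd_aboveI2)
  define S where "S = (SUP x\<in>halfspace w. J l x)"
  have "\<exists>x\<in>halfspace w. S - inverse (real (Suc k)) < J l x" for k
    using less_cSUP_iff[OF _ bdd, of "S - inverse (real (Suc k))"] zero_in_halfspace
    unfolding S_def by force
  then obtain x where x: "\<And>k. x k \<in> halfspace w"
    and S: "\<And>k. S - inverse (real (Suc k)) < J l (x k)" by metis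
  have lim: "(\<lambda>k. S - inverse (real (Suc k))) \<longlonglongrightarrow> S - 0"
    by (intro tendsto_intros LIMSEQ_inverse_real_of_nat)
  obtain y where y: "y \<in> halfspace w" "S - 0 \<le> J l y"
    by (rule halfspace_maximizing_subsequence[where l = "\<lambda>_. l", OF w x l tendsto_const _ lim])
      (use S less_imp_le in blast)+
  have "J l x \<le> J l y" if "x \<in> halfspace w" for x
    using cSUP_upper[OF that bdd] y(2) by (simp add: S_def)
  with y(1) that show ?thesis by blast
qed

text \<open>
  Along a weakly null sequence \<open>mass\<close> and \<open>I\<close> tend to zero, but the squared norm does not: the
  functional tends to \<open>t\<^sup>2 / 2\<close> at the points \<open>t z k\<close>, beyond any bound when \<open>t\<close> is large.
\<close>

lemma unit_sequence_not_weak_null: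
  assumes nz: "\<And>k. norm (z k) = 1" and weak: "weakly_converges z 0"
    and l: "\<And>k. l k \<le> b" and le: "\<And>k t. 0 \<le> t \<Longrightarrow> J (l k) (t *\<^sub>R z k) \<le> C"
  shows False
proof -
  (* any t with t^2 / 2 > C serves *)
  define t where "t = \<bar>C\<bar> + 2"
  have t: "0 \<le> t" by (simp add: t_def)
  have mass: "(\<lambda>k. mass (z k)) \<longlonglongrightarrow> 0"
    using weak_imp_mass_tendsto[of z 1 0] nz weak by (simp add: mass_def \<iota>.zero)
  have I: "(\<lambda>k. I (t *\<^sub>R z k)) \<longlonglongrightarrow> 0"
    using I_weak[OF weakly_converges_scaleR[OF weak], of t] I_zero by simp
  have "t\<^sup>2 / 2 - (1 + b) * (t\<^sup>2 * mass (z k)) - I (t *\<^sub>R z k) \<le> C" for k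
  proof -
    have "(1 + l k) * (t\<^sup>2 * mass (z k)) \<le> (1 + b) * (t\<^sup>2 * mass (z k))"
      using l mass_nonneg by (intro mult_right_mono) auto
    then show ?thesis using le[OF t, of k] nz[of k]
      by (simp add: J_mass mass_scaleR power_mult_distrib)
  qed
  moreover have "(\<lambda>k. t\<^sup>2 / 2 - (1 + b) * (t\<^sup>2 * mass (z k)) - I (t *\<^sub>R z k))
      \<longlonglongrightarrow> t\<^sup>2 / 2 - (1 + b) * (t\<^sup>2 * 0) - 0"
    by (intro tendsto_intros mass I)
  ultimately have "t\<^sup>2 / 2 - (1 + b) * (t\<^sup>2 * 0) - 0 \<le> C" using LIMSEQ_le_const2 by blast
  moreover have "t * 2 \<le> t * t" using t by (intro mult_left_mono) (simp_all add: t_def)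
  ultimately show False by (simp add: power2_eq_square t_def)
qed

section \<open>Nehari--Pankov points as maximisers\<close>

lemma J_has_derivative: "(J l has_derivative (\<lambda>y. q l x y - dfun I x y)) (at x)"
proof -
  have "((\<lambda>x. x \<bullet> x - (1 + l) * (\<iota> x \<bullet> \<iota> x)) has_derivative (\<lambda>y. 2 * q l x y)) (at x)"
    by (auto intro!: derivative_eq_intros \<iota>.has_derivative
        simp: q_def inner_commute[of _ x] inner_commute[of _ "\<iota> x"] algebra_simps)
  from has_derivative_mult_right[OF this, of "1/2"]
  have "((\<lambda>x. (x \<bullet> x - (1 + l) * (\<iota> x \<bullet> \<iota> x)) / 2) has_derivative q l x) (at x)"
    by simp
  moreover have "(I has_derivative dfun I x) (at x)"
    using I_diff frechet_derivative_works by blast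
  ultimately show ?thesis
    unfolding J_def[abs_def] q_def[of l x x for x] by (rule has_derivative_diff)
qed

lemma dfun_J: "dfun (J l) x = (\<lambda>y. q l x y - dfun I x y)"
  using frechet_derivative_at[OF J_has_derivative] by metis

text \<open>
  For a critical point of \<open>J l\<close> on \<open>V \<oplus> \<real>u\<close> the comparison inequality for \<open>I\<close> absorbs the
  mixed terms of the quadratic form: what is left is \<open>J l (v + t u) - J l u \<le> q l v v / 2\<close>, and the
  form is negative on \<open>V\<close>.
\<close>

lemma NP_strict_maximum:
  assumes u: "u \<in> NP l" and l: "a < l" and v: "v \<in> V" and t: "0 \<le> t"
    and ne: "v + t *\<^sub>R u \<noteq> u"
  shows "J l (v + t *\<^sub>R u) < J l u"
proof -
  define s where "s = t - 1"
  have ts: "t = 1 + s" and s: "s \<ge> -1" using t by (simp_all add: s_def)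
  have u0: "u \<noteq> 0" using u subspace_0[OF subspace_V] by (auto simp: NP_def)
  let ?w = "(s * (s / 2 + 1)) *\<^sub>R u + (1 + s) *\<^sub>R v"
  have "?w \<in> {v + t *\<^sub>R u | v t. v \<in> V}"
    using subspace_scale[OF subspace_V v] by (auto simp: add.commute)
  then have "dfun (J l) u ?w = 0" using u by (auto simp: NP_def)
  then have crit: "dfun I u ?w = s * (s / 2 + 1) * q l u u + (1 + s) * q l u v"
    by (simp add: dfun_J q_add_right q_scaleR_right)
  have "J l (v + t *\<^sub>R u) - J l u
      = q l v v / 2 + (I u - I ((1 + s) *\<^sub>R u + v) + dfun I u ?w)"
    unfolding J_def q_line crit ts by (simp add: power2_eq_square field_simps)
  moreover have "q l v v / 2 + (I u - I ((1 + s) *\<^sub>R u + v) + dfun I u ?w) < 0"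
  proof (cases "v = 0")
    case True
    then have "s \<noteq> 0" using ne by (auto simp: ts)
    then show ?thesis using I_ineq_strict[OF u0 s] True by (simp add: q_def \<iota>.zero)
  next
    case False
    then show ?thesis using I_ineq[OF u0 s, of v] q_neg_on_V[OF v _ l] by linarith
  qed
  ultimately show ?thesis by linarith
qed

lemma NP_pos:
  assumes "u \<in> NP l" "a < l" shows "0 < J l u"
proof -
  have "0 \<in> V" by (rule subspace_0[OF subspace_V])
  moreover from this have "u \<noteq> 0" using assms(1) by (auto simp: NP_def)
  ultimately show ?thesis using NP_strict_maximum[OF assms, of 0 0] by (simp add: J_zero)
qed

text \<open>
  The half-spaces are parametrised by unit vectors orthogonal to \<open>V\<close>, among which weak limits can be
  taken; the one through \<open>u\<close> has the normalised component of \<open>u\<close> orthogonal to \<open>V\<close> as its direction.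
\<close>

lemma halfspace_through:
  assumes u: "u \<notin> V"
  obtains w where "unit_perp w" "u \<in> halfspace w"
    "\<And>x. x \<in> halfspace w \<Longrightarrow> \<exists>v t. v \<in> V \<and> 0 \<le> t \<and> x = v + t *\<^sub>R u"
proof -
  define p where "p = u - proj n u"
  have p: "norm p > 0" using u by (auto simp: p_def V_iff)
  define w where "w = inverse (norm p) *\<^sub>R p"
  have pw: "norm p *\<^sub>R w = p" using p by (simp add: w_def)
  have "unit_perp w"
    using p by (auto simp: unit_perp_def w_def p_def inner_diff_left proj_inner)
  moreover have "u \<in> halfspace w"
    using halfspaceI[OF proj_in_V[of u], of "norm p" w] by (simp add: pw) (simp add: p_def)
  moreover have "\<exists>v t. v \<in> V \<and> 0 \<le> t \<and> x = v + t *\<^sub>R u" if "x \<in> halfspace w" for x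
  proof -
    obtain v t where x: "v \<in> V" "0 \<le> t" "x = v + t *\<^sub>R w"
      using \<open>x \<in> halfspace w\<close> unfolding halfspace_def by blast
    define s where "s = t * inverse (norm p)"
    have "x = (v - s *\<^sub>R proj n u) + s *\<^sub>R u"
      using x(3) by (simp add: w_def p_def s_def scaleR_diff_right)
    moreover have "v - s *\<^sub>R proj n u \<in> V"
      using x(1) proj_in_V subspace_V by (simp add: subspace_diff subspace_scale)
    moreover have "0 \<le> s" using x(2) by (simp add: s_def)
    ultimately show ?thesis by blast
  qed
  ultimately show ?thesis using that by blast
qed

lemma NP_strict_maximum_halfspace:
  assumes u: "u \<in> NP l" and l: "a < l"
  obtains w where "unit_perp w" "u \<in> halfspace w"
    "\<And>x. x \<in> halfspace w \<Longrightarrow> x \<noteq> u \<Longrightarrow> J l x < J l u"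
proof -
  have "u \<notin> V" using u by (simp add: NP_def)
  then obtain w where w: "unit_perp w" "u \<in> halfspace w"
    and sub: "\<And>x. x \<in> halfspace w \<Longrightarrow> \<exists>v t. v \<in> V \<and> 0 \<le> t \<and> x = v + t *\<^sub>R u"
    using halfspace_through by metis
  have "J l x < J l u" if "x \<in> halfspace w" "x \<noteq> u" for x
    using sub[OF that(1)] NP_strict_maximum[OF u l] that(2) by blast
  with w that show ?thesis by blast
qed

text \<open>
  Near \<open>0\<close> on the ray of \<open>w\<close> the positive quadratic part dominates \<open>I\<close>.
\<close>

lemma maximizer_positive:
  assumes w: "unit_perp w" and l: "l < b"
    and max: "\<And>x. x \<in> halfspace w \<Longrightarrow> J l x \<le> J l y"
  shows "0 < J l y"
proof -
  have w0: "w \<noteq> 0" using w by (auto simp: unit_perp_def)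
  have "\<forall>\<^sub>F t in at_right 0. I (t *\<^sub>R w) / t\<^sup>2 < q l w w / 2"
    using q_pos_on_perp[OF w l] by (intro order_tendstoD(2)[OF I_at_0[OF w0]]) simp
  then have "\<forall>\<^sub>F t in at_right (0::real). I (t *\<^sub>R w) / t\<^sup>2 < q l w w / 2 \<and> 0 < t"
    by (intro eventually_conj eventually_at_right_less)
  then obtain t :: real where t: "I (t *\<^sub>R w) / t\<^sup>2 < q l w w / 2" "0 < t"
    using eventually_happens'[OF trivial_limit_at_right_real] by blast
  have "0 < J l (t *\<^sub>R w)"
    using t by (simp add: J_def q_scaleR_right q_sym[of l "t *\<^sub>R w"] field_simps power2_eq_square)
  moreover have "t *\<^sub>R w \<in> halfspace w"
    using halfspaceI[OF subspace_0[OF subspace_V], of t w] t by simp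
  ultimately show ?thesis using max by force
qed

text \<open>
  The functional is at most \<open>0\<close> on \<open>V\<close>, so a positive maximum lies off the boundary of the half-space
  and is a critical point on the subspace that the half-space generates.
\<close>

lemma maximizer_in_NP:
  assumes w: "unit_perp w" and l: "a < l" "l < b" and y: "y \<in> halfspace w"
    and max: "\<And>x. x \<in> halfspace w \<Longrightarrow> J l x \<le> J l y"
  shows "y \<in> NP l"
proof -
  have pos: "0 < J l y" by (rule maximizer_positive[OF w l(2) max])
  have yV: "y \<notin> V"
  proof
    assume "y \<in> V"
    moreover have "y \<noteq> 0" using pos J_zero by auto
    ultimately have "q l y y < 0" by (intro q_neg_on_V l)
    then show False using pos I_nonneg[of y] by (simp add: J_def)
  qed
  obtain v0 t0 where y_eq: "y = v0 + t0 *\<^sub>R w" and v0: "v0 \<in> V" and t0: "0 \<le> t0"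
    using y unfolding halfspace_def by blast
  have "dfun (J l) y d = 0" if "d \<in> {v + t *\<^sub>R y | v t. v \<in> V}" for d
  proof -
    from that obtain v s where d: "d = v + s *\<^sub>R y" and v: "v \<in> V" by blast
    interpret D: bounded_linear "dfun (J l) y"
      unfolding dfun_J by (rule has_derivative_bounded_linear[OF J_has_derivative])
    have "(J l has_derivative dfun (J l) y) (at (y + 0 *\<^sub>R d))"
      unfolding dfun_J using J_has_derivative[of l y] by simp
    moreover have "((\<lambda>h. y + h *\<^sub>R d) has_derivative (\<lambda>h. h *\<^sub>R d)) (at 0)"
      by (auto intro!: derivative_eq_intros)
    ultimately have "((\<lambda>h. J l (y + h *\<^sub>R d)) has_derivative (\<lambda>h. dfun (J l) y (h *\<^sub>R d))) (at 0)"
      using has_derivative_compose by blast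
    then have "DERIV (\<lambda>h. J l (y + h *\<^sub>R d)) 0 :> dfun (J l) y d"
      by (simp add: has_field_derivative_def D.scaleR mult.commute[of _ "dfun (J l) y d"])
    moreover have "0 < inverse (\<bar>s\<bar> + 1)" by (simp add: add_nonneg_pos)
    moreover have "J l (y + h *\<^sub>R d) \<le> J l (y + 0 *\<^sub>R d)" if h: "\<bar>0 - h\<bar> < inverse (\<bar>s\<bar> + 1)" for h
    proof -
      have "\<bar>h\<bar> * (\<bar>s\<bar> + 1) < 1" using h by (simp add: field_simps add_nonneg_pos)
      moreover have "\<bar>h * s\<bar> \<le> \<bar>h\<bar> * (\<bar>s\<bar> + 1)" by (simp add: abs_mult algebra_simps)
      ultimately have "0 \<le> 1 + h * s" by linarith
      moreover have "y + h *\<^sub>R d = (v0 + h *\<^sub>R v + (h * s) *\<^sub>R v0) + ((1 + h * s) * t0) *\<^sub>R w"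
        by (simp add: d y_eq algebra_simps)
      moreover have "v0 + h *\<^sub>R v + (h * s) *\<^sub>R v0 \<in> V"
        using v0 v subspace_V by (simp add: subspace_add subspace_scale)
      ultimately have "y + h *\<^sub>R d \<in> halfspace w" using t0 halfspaceI by simp
      then show ?thesis using max by simp
    qed
    ultimately show ?thesis using DERIV_local_max by blast
  qed
  with yV show ?thesis by (simp add: NP_def)
qed

section \<open>The minimax level as a function of the parameter\<close>

lemma c_le: "u \<in> NP l \<Longrightarrow> a < l \<Longrightarrow> c l \<le> J l u"
  unfolding c_def by (intro cINF_lower bdd_belowI2[of _ 0]) (auto dest: NP_pos less_imp_le)

lemma c_le_halfspace:
  assumes w: "unit_perp w" and l: "a < l" "l < b"
  obtains y where "y \<in> halfspace w" "y \<in> NP l" "c l \<le> J l y" "\<And>x. x \<in> halfspace w \<Longrightarrow> J l x \<le> J l y"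
proof -
  have "0 \<le> l" using a_nonneg l by simp
  then obtain y where y: "y \<in> halfspace w" "\<And>x. x \<in> halfspace w \<Longrightarrow> J l x \<le> J l y"
    using maximizer_exists[OF w] by blast
  then have "y \<in> NP l" using maximizer_in_NP[OF w l] by blast
  then show ?thesis using that y c_le l by blast
qed

lemma NP_nonempty: "a < l \<Longrightarrow> l < b \<Longrightarrow> NP l \<noteq> {}"
  using c_le_halfspace[OF unit_perp_e] by blast

lemma c_nonneg: "a < l \<Longrightarrow> l < b \<Longrightarrow> 0 \<le> c l"
  unfolding c_def using NP_nonempty by (intro cINF_greatest) (auto dest: NP_pos less_imp_le)

text \<open>
  Near-optimal points at \<open>l k\<close> are maxima over half-spaces with directions \<open>w k\<close>, and a weak limit of
  these directions cannot vanish. By weak lower semicontinuity the functional is at most \<open>C0\<close> on the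
  half-space of the limit, in particular at the maximiser there. This gives lower semicontinuity of \<open>c\<close>
  and, for constant sequences, attainment of \<open>c l\<close>.
\<close>

lemma c_limit_attained:
  assumes l: "\<And>k. a < l k" "\<And>k. l k < b" "l \<longlonglongrightarrow> L" and L: "a < L" "L < b"
    and C: "\<And>k. c (l k) \<le> C k" "C \<longlonglongrightarrow> C0"
  obtains u where "u \<in> NP L" "J L u \<le> C0"
proof -
  define D where "D k = C k + inverse (real (Suc k))" for k
  have D: "D \<longlonglongrightarrow> C0"
    using tendsto_add[OF C(2) LIMSEQ_inverse_real_of_nat] by (simp add: D_def[abs_def])
  have "\<exists>w. unit_perp w \<and> (\<forall>x\<in>halfspace w. J (l k) x \<le> D k)" for k
  proof -
    have "0 < inverse (real (Suc k))" by simp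
    then have "c (l k) < D k" using C(1)[of k] unfolding D_def by linarith
    moreover have "bdd_below (J (l k) ` NP (l k))"
      using NP_pos l(1) by (intro bdd_belowI2[of _ 0]) (auto intro: less_imp_le)
    ultimately obtain u where u: "u \<in> NP (l k)" "J (l k) u < D k"
      using cINF_less_iff[OF NP_nonempty[OF l(1,2)]] unfolding c_def by blast
    obtain w where w: "unit_perp w"
      and less: "\<And>x. x \<in> halfspace w \<Longrightarrow> x \<noteq> u \<Longrightarrow> J (l k) x < J (l k) u"
      using NP_strict_maximum_halfspace[OF u(1) l(1)] by metis
    have "J (l k) x \<le> D k" if "x \<in> halfspace w" for x
      using less[OF that] u(2) by (cases "x = u") auto
    with w show ?thesis by blast
  qed
  then obtain w where w: "\<And>k. unit_perp (w k)"
    and le: "\<And>k x. x \<in> halfspace (w k) \<Longrightarrow> J (l k) x \<le> D k" by metis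
  have nw: "norm (w k) = 1" for k using w by (simp add: unit_perp_def)
  then obtain r w0 where r: "strict_mono r" and weak: "weakly_converges (w \<circ> r) w0"
    using bounded_imp_weakly_convergent_subsequence[of w 1] by auto
  have lr: "(l \<circ> r) \<longlonglongrightarrow> L" and Dr: "(D \<circ> r) \<longlonglongrightarrow> C0"
    using LIMSEQ_subseq_LIMSEQ[OF _ r] l(3) D by auto
  obtain K where K: "\<And>k. norm (D k) \<le> K"
    using convergent_imp_Bseq[OF convergentI[OF D]] unfolding Bseq_def by blast
  have "w0 \<noteq> 0"
  proof
    assume "w0 = 0"
    show False
    proof (rule unit_sequence_not_weak_null)
      show "weakly_converges (w \<circ> r) 0" using weak \<open>w0 = 0\<close> by simp
      show "norm ((w \<circ> r) k) = 1" "(l \<circ> r) k \<le> b" for k using nw less_imp_le[OF l(2)] by simp_all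
      show "J ((l \<circ> r) k) (t *\<^sub>R (w \<circ> r) k) \<le> K" if "0 \<le> t" for k t
      proof -
        have "t *\<^sub>R w (r k) \<in> halfspace (w (r k))"
          using halfspaceI[OF subspace_0[OF subspace_V] that] by simp
        then show ?thesis using le K[of "r k"] by (force simp: abs_le_iff)
      qed
    qed
  qed
  have limit: "J L (v + t *\<^sub>R w0) \<le> C0" if v: "v \<in> V" and t: "0 \<le> t" for v t
  proof (rule weakly_lower_semicontinuous)
    show "weakly_converges (\<lambda>k. v + t *\<^sub>R (w \<circ> r) k) (v + t *\<^sub>R w0)"
      using weakly_converges_scaleR[OF weak, of t] unfolding weakly_converges_def
      by (auto simp: bounded_linear.linear linear_add intro!: tendsto_add_const_iff[THEN iffD2])
    show "norm (v + t *\<^sub>R (w \<circ> r) k) \<le> norm v + t" for k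
      using norm_triangle_ineq[of v "t *\<^sub>R w (r k)"] nw t by simp
    show "J ((l \<circ> r) k) (v + t *\<^sub>R (w \<circ> r) k) \<le> (D \<circ> r) k" for k
      using le halfspaceI[OF v t] by simp
  qed (rule lr Dr)+
  define w1 where "w1 = inverse (norm w0) *\<^sub>R w0"
  have "w0 \<bullet> e i = 0" if "i < n" for i
    using weakly_convergesD_inner[OF weak, of "e i"] w that
    by (simp add: unit_perp_def LIMSEQ_const_iff)
  then have "unit_perp w1" using \<open>w0 \<noteq> 0\<close> by (simp add: unit_perp_def w1_def)
  then obtain u where u: "u \<in> halfspace w1" "u \<in> NP L" using c_le_halfspace L by metis
  then obtain v t where "v \<in> V" "0 \<le> t" "u = v + (t * inverse (norm w0)) *\<^sub>R w0"
    unfolding halfspace_def w1_def by auto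
  then have "J L u \<le> C0" using limit by simp
  with u that show ?thesis by blast
qed

lemma c_attained:
  assumes "a < l" "l < b" obtains u where "u \<in> NP l" "J l u = c l"
proof -
  obtain u where "u \<in> NP l" "J l u \<le> c l"
    using c_limit_attained[of "\<lambda>_. l" l "\<lambda>_. c l" "c l"] assms by auto
  then show ?thesis using that c_le[of u l] assms by force
qed

text \<open>
  The maximisers \<open>x k\<close> of \<open>J (mu k)\<close> on the half-space converge, along a subsequence, to its unique
  maximiser \<open>y\<close> for the parameter \<open>l\<close>. As the functionals differ by \<open>(l - mu k) mass\<close>, comparing
  \<open>J l (x k) \<le> J l y\<close> with the assumed lower bound for \<open>c (mu k) \<le> J (mu k) (x k)\<close> yields the sign.
  The case \<open>l = b\<close>, \<open>y = 0\<close> is included.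
\<close>

lemma perturbed_maximizers:
  assumes w: "unit_perp w" and y: "y \<in> halfspace w"
    and max: "\<And>x. x \<in> halfspace w \<Longrightarrow> x \<noteq> y \<Longrightarrow> J l x < J l y"
    and mu: "\<And>k. a < mu k" "\<And>k. mu k < b" "mu \<longlonglongrightarrow> l"
    and le: "\<And>k. J l y + m * l \<le> c (mu k) + m * mu k"
  obtains r x where "(\<lambda>k. mass (x k)) \<longlonglongrightarrow> mass y"
    "\<And>k::nat. 0 \<le> (l - mu (r k)) * (mass (x k) - m)"
proof -
  have "\<exists>x. x \<in> halfspace w \<and> c (mu k) \<le> J (mu k) x" for k
    using c_le_halfspace[OF w mu(1,2)] by metis
  then obtain x where x: "\<And>k. x k \<in> halfspace w" and cx: "\<And>k. c (mu k) \<le> J (mu k) (x k)" by metis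
  have low: "J l y + m * (l - mu k) \<le> J (mu k) (x k)" for k
    using le[of k] cx[of k] by (simp add: algebra_simps)
  have mu0: "0 \<le> mu k" for k using mu(1)[of k] a_nonneg by simp
  have "(\<lambda>k. J l y + m * (l - mu k)) \<longlonglongrightarrow> J l y + m * (l - l)"
    by (intro tendsto_intros mu)
  then obtain r u where r: "strict_mono r" and u: "u \<in> halfspace w" "(x \<circ> r) \<longlonglongrightarrow> u"
    and "J l y + m * (l - l) \<le> J l u"
    using halfspace_maximizing_subsequence[OF w x mu0 mu(3) low] by blast
  then have "u = y" using max[of u] by force
  then have "(\<lambda>k. mass ((x \<circ> r) k)) \<longlonglongrightarrow> mass y" using u(2) mass_tendsto by blast
  moreover have "0 \<le> (l - mu (r k)) * (mass ((x \<circ> r) k) - m)" for k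
  proof -
    have "J l (x (r k)) \<le> J l y" using max[OF x] by (cases "x (r k) = y") (auto intro: less_imp_le)
    then show ?thesis
      using low[of "r k"] J_shift[of "mu (r k)" "x (r k)" l] by (simp add: algebra_simps)
  qed
  ultimately show ?thesis using that by blast
qed

text \<open>
  The number \<open>d\<close> selects the side of \<open>l\<close> and how far from it one may move. To first order, at a
  step \<open>h\<close> from \<open>l\<close> towards \<open>d\<close>, the value \<open>c mu + m mu\<close> exceeds \<open>J l y + m l\<close> by at most
  \<open>h (m - mass y)\<close>, which is negative.
\<close>

lemma decrease_towards:
  assumes w: "unit_perp w" and y: "y \<in> halfspace w"
    and max: "\<And>x. x \<in> halfspace w \<Longrightarrow> x \<noteq> y \<Longrightarrow> J l x < J l y"
    and l: "l \<in> {a..b}" and d: "d \<in> {a..b}" and m: "0 < (d - l) * (mass y - m)"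
  obtains mu where "min l d < mu" "mu < max l d" "c mu + m * mu < J l y + m * l"
proof (rule ccontr)
  assume no: "\<not> thesis"
  note found = that
  have le: "J l y + m * l \<le> c mu + m * mu" if "min l d < mu" "mu < max l d" for mu
    using found[OF that] no by force
  define s where "s k = inverse (real (Suc (Suc k)))" for k
  have s: "0 < s k" "s k < 1" for k by (simp_all add: s_def inverse_less_1_iff)
  define mu where "mu k = l + s k * (d - l)" for k
  have "s \<longlonglongrightarrow> 0" unfolding s_def by (rule LIMSEQ_Suc[OF LIMSEQ_inverse_real_of_nat])
  then have "(\<lambda>k. l + s k * (d - l)) \<longlonglongrightarrow> l + 0 * (d - l)" by (intro tendsto_intros)
  then have lim: "mu \<longlonglongrightarrow> l" by (simp add: mu_def[abs_def])
  have mu: "min l d < mu k" "mu k < max l d" for k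
  proof -
    have part: "0 < s k * h" "s k * h < h" if "0 < h" for h
      using s[of k] that by simp_all
    have "min l d < mu k \<and> mu k < max l d"
    proof (cases "l < d")
      case True
      then show ?thesis using part[of "d - l"] unfolding mu_def by linarith
    next
      case False
      then have "d < l" using m by (cases "d = l") auto
      moreover have "s k * (d - l) = - (s k * (l - d))" by (simp add: algebra_simps)
      ultimately show ?thesis using part[of "l - d"] unfolding mu_def by linarith
    qed
    then show "min l d < mu k" "mu k < max l d" by auto
  qed
  have mu_ab: "a < mu k" "mu k < b" for k using mu[of k] l d by auto
  obtain r x where x: "(\<lambda>k. mass (x k)) \<longlonglongrightarrow> mass y"
    and sgn: "\<And>k::nat. 0 \<le> (l - mu (r k)) * (mass (x k) - m)"
    using perturbed_maximizers[OF w y max mu_ab lim le[OF mu]] by metis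
  have "(d - l) * (mass (x k) - m) \<le> 0" for k
  proof -
    have "s (r k) * ((d - l) * (mass (x k) - m)) \<le> 0"
      using sgn[of k] by (simp add: mu_def algebra_simps)
    then show ?thesis using s(1)[of "r k"] by (meson mult_pos_pos not_le)
  qed
  moreover have "(\<lambda>k. (d - l) * (mass (x k) - m)) \<longlonglongrightarrow> (d - l) * (mass y - m)"
    by (intro tendsto_intros x)
  ultimately have "(d - l) * (mass y - m) \<le> 0" using LIMSEQ_le_const2 by blast
  with m show False by simp
qed

section \<open>The masses of the ground states fill an interval\<close>

text \<open>
  On the span of \<open>V\<close> and \<open>e n\<close> no eigenvalue exceeds \<open>b\<close>, so the quadratic part is not positive there
  and \<open>J b x \<le> - I x\<close>.
\<close>

lemma strict_maximum_at_b:
  assumes "x \<in> halfspace (e n)" "x \<noteq> 0" shows "J b x < J b 0"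
proof -
  obtain v t where x: "x = v + t *\<^sub>R e n" and v: "v \<in> V"
    using assms(1) unfolding halfspace_def by blast
  have "proj (Suc n) v = v"
    using v V_iff[of v] V_perp_high[OF v order_refl] by (simp add: proj_def)
  moreover have "proj (Suc n) (e n) = e n" by (simp add: proj_def orth)
  ultimately have "proj (Suc n) x = x"
    by (simp add: x linear_add[OF linear_proj] linear_scale[OF linear_proj])
  moreover have "ev i \<le> b" if "i < Suc n" for i
    using that ev_low[of i] ev_n a_less_b by (cases "i = n") auto
  ultimately have "(norm x)\<^sup>2 \<le> (1 + b) * (2 * mass x)" by (intro mass_low_ge[of "Suc n"])
  then show ?thesis using I_pos[OF assms(2)] unfolding J_zero by (simp add: J_def q_mass)
qed

definition ground_state :: "real \<Rightarrow> 'e \<Rightarrow> bool" where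
  "ground_state l u \<longleftrightarrow> a < l \<and> l < b \<and> u \<in> NP l \<and> J l u = c l"

lemma ground_state_decrease:
  assumes u: "ground_state l u" and d: "d \<in> {a..b}" and m: "0 < (d - l) * (mass u - m)"
  obtains mu where "min l d < mu" "mu < max l d" "c mu + m * mu < c l + m * l"
proof -
  have l: "a < l" "l < b" and NP: "u \<in> NP l" and c: "J l u = c l"
    using u by (simp_all add: ground_state_def)
  obtain w where "unit_perp w" "u \<in> halfspace w"
    "\<And>x. x \<in> halfspace w \<Longrightarrow> x \<noteq> u \<Longrightarrow> J l x < J l u"
    using NP_strict_maximum_halfspace[OF NP l(1)] by metis
  moreover have "l \<in> {a..b}" using l by simp
  ultimately obtain mu where "min l d < mu" "mu < max l d" "c mu + m * mu < J l u + m * l"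
    using decrease_towards d m by metis
  then show ?thesis using that c by simp
qed

text \<open>
  The parameter sought is an interior minimum of \<open>c l + m l\<close> on the interval from \<open>l0\<close> to \<open>b\<close>. Moving
  right from \<open>l0\<close> decreases this function, since \<open>m < mass u0\<close>; moving left from \<open>b\<close> brings it below
  \<open>m b\<close>, since the maximiser \<open>0\<close> has mass less than \<open>m\<close>. At an interior minimum neither direction
  decreases it, which leaves \<open>m\<close> as the only possible mass of a ground state.
\<close>

lemma smaller_mass_attained:
  assumes u0: "ground_state l0 u0" and m: "0 < m" "m < mass u0"
  obtains l u where "ground_state l u" "mass u = m"
proof -
  have l0: "a < l0" "l0 < b" using u0 by (simp_all add: ground_state_def)
  define f where "f l = c l + m * l" for l
  define g where "g = (INF l\<in>{l0..<b}. f l)"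
  have f_ge: "m * l \<le> f l" if "l \<in> {l0..<b}" for l
    using c_nonneg[of l] that l0 by (simp add: f_def)
  have "0 \<le> f l" if "l \<in> {l0..<b}" for l
  proof -
    have "0 \<le> m * l" using m l0 a_nonneg that by simp
    then show ?thesis using f_ge[OF that] by linarith
  qed
  then have bdd: "bdd_below (f ` {l0..<b})" by (intro bdd_belowI2)
  have ne: "{l0..<b} \<noteq> {}" using l0 by auto
  have g_le: "g \<le> f l" if "l \<in> {l0..<b}" for l
    unfolding g_def by (rule cINF_lower[OF bdd that])
  have "\<exists>l\<in>{l0..<b}. f l < g + inverse (real (Suc k))" for k
    using cINF_less_iff[OF ne bdd, of "g + inverse (real (Suc k))"] by (simp add: g_def)
  then obtain l where l: "\<And>k. l k \<in> {l0..<b}" and fl: "\<And>k. f (l k) < g + inverse (real (Suc k))"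
    by metis
  have "l k \<in> {l0..b}" for k using l[of k] by simp
  then obtain L r where L: "L \<in> {l0..b}" and r: "strict_mono r" and lr: "(l \<circ> r) \<longlonglongrightarrow> L"
    using compact_imp_seq_compact[OF compact_Icc[of l0 b]] unfolding seq_compact_def by blast
  have gr: "(\<lambda>k. g + inverse (real (Suc (r k)))) \<longlonglongrightarrow> g"
    using LIMSEQ_subseq_LIMSEQ[OF tendsto_add[OF tendsto_const[of g] LIMSEQ_inverse_real_of_nat] r]
    by (simp add: o_def)
  have "g < m * b"
  proof -
    have "0 < (l0 - b) * (mass 0 - m)" using l0 m by (simp add: mass_def \<iota>.zero mult_neg_pos)
    then obtain mu where "min b l0 < mu" "mu < max b l0" "c mu + m * mu < J b 0 + m * b"
      using decrease_towards[OF unit_perp_e zero_in_halfspace strict_maximum_at_b, of l0 m] l0 a_less_b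
      by auto
    then show ?thesis using g_le[of mu] l0 by (simp add: f_def J_zero)
  qed
  moreover have "m * L \<le> g"
  proof (rule LIMSEQ_le)
    show "(\<lambda>k. m * (l \<circ> r) k) \<longlonglongrightarrow> m * L" by (intro tendsto_intros lr)
    have "m * (l \<circ> r) k \<le> g + inverse (real (Suc (r k)))" for k
      using f_ge[OF l, of "r k"] fl[of "r k"] by simp
    then show "\<exists>N. \<forall>k\<ge>N. m * (l \<circ> r) k \<le> g + inverse (real (Suc (r k)))" by blast
  qed (rule gr)
  ultimately have "L \<noteq> b" by auto
  then have Lb: "L \<in> {l0..<b}" "a < L" "L < b" using L l0 by auto
  obtain u where u: "u \<in> NP L" "J L u \<le> g - m * L"
  proof (rule c_limit_attained)
    show "a < (l \<circ> r) k" "(l \<circ> r) k < b" for k using l[of "r k"] l0 by auto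
    show "c ((l \<circ> r) k) \<le> g + inverse (real (Suc (r k))) - m * (l \<circ> r) k" for k
      using fl[of "r k"] by (simp add: f_def)
    show "(\<lambda>k. g + inverse (real (Suc (r k))) - m * (l \<circ> r) k) \<longlonglongrightarrow> g - m * L"
      by (intro tendsto_diff gr tendsto_mult_left lr)
  qed (rule lr Lb)+
  have fL: "f L = g" and JL: "J L u = c L"
    using c_le[OF u(1) Lb(2)] g_le[OF Lb(1)] u(2) by (simp_all add: f_def)
  have gs: "ground_state L u" using u(1) JL Lb by (simp add: ground_state_def)
  have no: "c L + m * L \<le> c mu + m * mu" if "mu \<in> {l0..<b}" for mu
    using g_le[OF that] fL by (simp add: f_def)
  have "L \<noteq> l0"
  proof
    assume "L = l0"
    have "0 < (b - l0) * (mass u0 - m)" using l0 m by simp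
    then obtain mu where "min l0 b < mu" "mu < max l0 b" "c mu + m * mu < c l0 + m * l0"
      using ground_state_decrease[OF u0, of b m] a_less_b by auto
    then show False using no[of mu] l0 \<open>L = l0\<close> by simp
  qed
  then have "l0 < L" using L by simp
  have "\<not> mass u < m"
  proof
    assume "mass u < m"
    then have "0 < (l0 - L) * (mass u - m)" using \<open>l0 < L\<close> by (simp add: mult_neg_neg)
    then obtain mu where "min L l0 < mu" "mu < max L l0" "c mu + m * mu < c L + m * L"
      using ground_state_decrease[OF gs, of l0 m] l0 by auto
    then show False using no[of mu] \<open>l0 < L\<close> Lb by simp
  qed
  moreover have "\<not> m < mass u"
  proof
    assume "m < mass u"
    then have "0 < (b - L) * (mass u - m)" using Lb by simp
    then obtain mu where "min L b < mu" "mu < max L b" "c mu + m * mu < c L + m * L"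
      using ground_state_decrease[OF gs, of b m] a_less_b by auto
    then show False using no[of mu] Lb by simp
  qed
  ultimately show ?thesis using that[OF gs] by simp
qed

text \<open>
  The levels are bounded uniformly in \<open>l\<close> by comparison with the half-space of \<open>e n\<close>. Ground states of
  unbounded mass would have directions that tend weakly to zero, by superquadratic growth, and then
  their rays would carry arbitrarily large values of the functional, above their levels.
\<close>

lemma ground_state_mass_bounded:
  obtains G where "\<And>l u. ground_state l u \<Longrightarrow> mass u \<le> G"
proof (rule ccontr)
  assume no: "\<not> thesis"
  note found = that
  have "\<exists>l u. ground_state l u \<and> (real k)\<^sup>2 < mass u" for k :: nat
    using found[of "(real k)\<^sup>2"] no by force
  then obtain l u where gs: "\<And>k. ground_state (l k) (u k)" and big: "\<And>k::nat. (real k)\<^sup>2 < mass (u k)"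
    by metis
  have l: "a < l k" "l k < b" "0 \<le> l k" and NP: "u k \<in> NP (l k)" and Jc: "J (l k) (u k) = c (l k)" for k
    using gs[of k] a_nonneg by (simp_all add: ground_state_def)
  have norm: "real k < norm (u k)" for k
  proof (rule power2_less_imp_less)
    have "(1 + 0) * (2 * mass (u k)) \<le> (norm (u k))\<^sup>2"
      by (rule mass_high_le[of 0]) (use ev_nonneg in auto)
    then show "(real k)\<^sup>2 < (norm (u k))\<^sup>2" using big[of k] mass_nonneg[of "u k"] by simp
  qed simp
  obtain R where R: "\<And>x l. x \<in> halfspace (e n) \<Longrightarrow> 0 \<le> l \<Longrightarrow> - 0 \<le> J l x \<Longrightarrow> norm x \<le> R"
    using halfspace_coercive[OF unit_perp_e] by blast
  have level: "J (l k) (u k) \<le> R\<^sup>2 / 2" for k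
  proof -
    obtain y where y: "y \<in> halfspace (e n)" "y \<in> NP (l k)" "c (l k) \<le> J (l k) y"
      using c_le_halfspace[OF unit_perp_e l(1,2)] by metis
    have "norm y \<le> R" by (rule R[OF y(1) l(3)[of k]]) (use NP_pos[OF y(2) l(1)] in simp)
    then have "(norm y)\<^sup>2 \<le> R\<^sup>2" by (intro power_mono) auto
    then show ?thesis using J_le_norm[OF l(3)[of k], of y] y(3) Jc[of k] by simp
  qed
  define z where "z k = inverse (norm (u k)) *\<^sub>R u k" for k
  have nz: "norm (z k) = 1" for k
  proof -
    have "u k \<noteq> 0" using norm[of k] by auto
    then show ?thesis by (simp add: z_def)
  qed
  then obtain r z0 where r: "strict_mono r" and weak: "weakly_converges (z \<circ> r) z0"
    using bounded_imp_weakly_convergent_subsequence[of z 1] by auto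
  have "z0 = 0"
  proof (rule escaping_direction_weak_null)
    show "weakly_converges (\<lambda>k. inverse (norm ((u \<circ> r) k)) *\<^sub>R (u \<circ> r) k) z0"
      using weak by (simp add: z_def o_def)
    show "real k < norm ((u \<circ> r) k)" for k
      using norm[of "r k"] seq_suble[OF r, of k] by (simp add: order_le_less_trans)
    show "- 0 \<le> J ((l \<circ> r) k) ((u \<circ> r) k)" "0 \<le> (l \<circ> r) k" for k
      using NP_pos[OF NP l(1), of "r k"] l(3) by simp_all
  qed
  show False
  proof (rule unit_sequence_not_weak_null)
    show "weakly_converges (z \<circ> r) 0" using weak \<open>z0 = 0\<close> by simp
    show "norm ((z \<circ> r) k) = 1" "(l \<circ> r) k \<le> b" for k using nz less_imp_le[OF l(2)] by simp_all
    show "J ((l \<circ> r) k) (t *\<^sub>R (z \<circ> r) k) \<le> R\<^sup>2 / 2" if "0 \<le> t" for k t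
    proof -
      have "J (l (r k)) (0 + (t * inverse (norm (u (r k)))) *\<^sub>R u (r k)) \<le> J (l (r k)) (u (r k))"
        using NP_strict_maximum[OF NP l(1) subspace_0[OF subspace_V], of "t * inverse (norm (u (r k)))" "r k"] that
        by fastforce
      then show ?thesis using level[of "r k"] by (simp add: z_def)
    qed
  qed
qed

lemma masses_fill_interval:
  defines "M \<equiv> {mass u | u l. ground_state l u}"
  shows "\<exists>g>0. {0<..<g} \<subseteq> M \<and> M \<subseteq> {0<..g}"
proof -
  obtain G where "\<And>l u. ground_state l u \<Longrightarrow> mass u \<le> G"
    using ground_state_mass_bounded by blast
  then have bdd: "bdd_above M" unfolding M_def bdd_above_def by blast
  have pos: "0 < x" if "x \<in> M" for x
  proof -
    from that obtain u l where u: "x = mass u" "ground_state l u" unfolding M_def by blast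
    then have "u \<noteq> 0" using NP_pos[of u l] J_zero[of l] by (auto simp: ground_state_def)
    then show ?thesis using u mass_pos by simp
  qed
  obtain u where "u \<in> NP ((a + b) / 2)" "J ((a + b) / 2) u = c ((a + b) / 2)"
    using c_attained[of "(a + b) / 2"] a_less_b by auto
  then have "ground_state ((a + b) / 2) u" using a_less_b by (simp add: ground_state_def)
  then have in_M: "mass u \<in> M" unfolding M_def by blast
  then have "0 < Sup M" using pos cSup_upper[OF _ bdd] by (meson less_le_trans)
  moreover have "M \<subseteq> {0<..Sup M}" using pos cSup_upper[OF _ bdd] by auto
  moreover have "{0<..<Sup M} \<subseteq> M"
  proof
    fix m assume m: "m \<in> {0<..<Sup M}"
    then obtain m0 where "m0 \<in> M" "m < m0"
      using less_cSup_iff[OF _ bdd] in_M by auto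
    then obtain u0 l0 where gs: "ground_state l0 u0" "m < mass u0" unfolding M_def by blast
    have "0 < m" using m by simp
    then obtain l u where "ground_state l u" "mass u = m"
      using smaller_mass_attained[OF gs(1) _ gs(2)] by blast
    then show "m \<in> M" unfolding M_def by blast
  qed
  ultimately show ?thesis by blast
qed

end

section \<open>From the operator to the abstract setting\<close>

lemma orthogonal_to_dense_span:
  fixes x :: "'a::real_inner"
  assumes "closure (span S) = UNIV" "\<And>y. y \<in> S \<Longrightarrow> x \<bullet> y = 0"
  shows "x = 0"
proof -
  have "span S \<subseteq> {y. x \<bullet> y = 0}"
    by (rule span_minimal) (use assms(2) in \<open>auto simp: subspace_def inner_add_right\<close>)
  moreover have "closed {y. x \<bullet> y = 0}" by (intro closed_Collect_eq continuous_intros)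
  ultimately have "closure (span S) \<subseteq> {y. x \<bullet> y = 0}" by (rule closure_minimal)
  then have "x \<in> {y. x \<bullet> y = 0}" using assms(1) by blast
  then show ?thesis by simp
qed

lemma form_domain_bounded_linear:
  assumes "is_form_domain DB B \<iota>" shows "bounded_linear \<iota>"
proof -
  have "norm (\<iota> x) \<le> norm x * 1" for x
  proof -
    have "x \<bullet> x = \<iota> x \<bullet> \<iota> x + B (\<iota> x) \<bullet> B (\<iota> x)"
      using assms by (auto simp: is_form_domain_def)
    then show ?thesis by (simp add: norm_le)
  qed
  then show ?thesis
    using assms unfolding is_form_domain_def bounded_linear_def bounded_linear_axioms_def by blast
qed

text \<open>
  An eigenvector \<open>z\<close> has graph scalar product \<open>(1 + L) (\<iota> x \<bullet> z)\<close> with every vector \<open>x\<close> of the form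
  domain, so an eigenbasis of \<open>H\<close> is orthogonal, and after rescaling orthonormal, there as well.
\<close>

lemma form_inner_eigenvector:
  assumes B: "is_operator_sqrt D A DB B" and E: "is_form_domain DB B \<iota>"
    and z: "z \<in> D" "A z = L *\<^sub>R z" "\<iota> y = z"
  shows "x \<bullet> y = (1 + L) * (\<iota> x \<bullet> z)"
proof -
  have "\<iota> x \<in> DB" "B z \<in> DB" "B (B z) = A z"
    using B E z(1) by (auto simp: is_form_domain_def is_operator_sqrt_def)
  then have "B (\<iota> x) \<bullet> B z = \<iota> x \<bullet> (L *\<^sub>R z)"
    using B z(2) by (simp add: is_operator_sqrt_def self_adjoint_operator_def)
  then show ?thesis using E z(3) by (simp add: is_form_domain_def algebra_simps)
qed

lemma form_domain_eigenbasis: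
  fixes \<iota> :: "'e::{real_inner,banach} \<Rightarrow> 'h::real_inner"
  assumes B: "is_operator_sqrt D A DB B" and E: "is_form_domain DB B \<iota>"
    and basis: "eigenbasis D A ev \<zeta>"
  obtains e where "compact_form e \<iota> (\<lambda>i. ev (Suc i))"
    "\<And>i. \<iota> (e i) = (1 / sqrt (1 + ev (Suc i))) *\<^sub>R \<zeta> (Suc i)"
proof -
  interpret \<iota>: bounded_linear \<iota> by (rule form_domain_bounded_linear[OF E])
  have eigen: "\<zeta> (Suc i) \<in> D" "A (\<zeta> (Suc i)) = ev (Suc i) *\<^sub>R \<zeta> (Suc i)" for i
    using basis by (simp_all add: eigenbasis_def)
  have ev: "0 \<le> ev (Suc i)" for i
  proof -
    have "ev 1 \<le> ev (Suc i)" using basis by (auto simp: eigenbasis_def elim!: mono_onD)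
    then show ?thesis using basis by (simp add: eigenbasis_def)
  qed
  define s where "s i = sqrt (1 + ev (Suc i))" for i
  have s: "s i > 0" "s i * s i = 1 + ev (Suc i)" for i
    using ev[of i] by (simp_all add: s_def add_pos_nonneg)
  have "\<exists>y. \<iota> y = \<zeta> (Suc i)" for i
    using B E eigen(1)[of i] by (auto simp: is_form_domain_def is_operator_sqrt_def)
  then obtain y where y: "\<And>i. \<iota> (y i) = \<zeta> (Suc i)" by metis
  define e where "e i = (1 / s i) *\<^sub>R y i" for i
  have inner_e: "x \<bullet> e i = s i * (\<iota> x \<bullet> \<zeta> (Suc i))" for x i
    using form_inner_eigenvector[OF B E eigen y, of x i] s(1)[of i]
    unfolding s(2)[symmetric] by (simp add: e_def)
  have \<iota>_e: "\<iota> (e i) = (1 / s i) *\<^sub>R \<zeta> (Suc i)" for i by (simp add: e_def \<iota>.scaleR y)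
  have "compact_form e \<iota> (\<lambda>i. ev (Suc i))"
  proof
    show "e i \<bullet> e j = (if i = j then 1 else 0)" for i j
      using basis s(1)[of j] unfolding inner_e \<iota>_e by (simp add: eigenbasis_def)
    show "x = 0" if "\<And>i. x \<bullet> e i = 0" for x
    proof -
      have "\<iota> x \<bullet> z = 0" if z: "z \<in> \<zeta> ` {1..}" for z
      proof -
        from z obtain k where k: "k \<ge> 1" "z = \<zeta> k" by auto
        then obtain i where "k = Suc i" by (cases k) auto
        then show ?thesis using \<open>\<And>i. x \<bullet> e i = 0\<close>[of i] s(1)[of i] k by (simp add: inner_e)
      qed
      then have "\<iota> x = 0"
        using basis orthogonal_to_dense_span[of "\<zeta> ` {1..}" "\<iota> x"] by (simp add: eigenbasis_def)
      moreover have "B 0 = 0"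
      proof -
        have "densely_defined_operator DB B"
          using B by (simp add: is_operator_sqrt_def self_adjoint_operator_def)
        then have "0 \<in> DB" "\<forall>u\<in>DB. \<forall>r. B (r *\<^sub>R u) = r *\<^sub>R B u"
          by (auto simp: densely_defined_operator_def subspace_0)
        then have "B (0 *\<^sub>R 0) = 0 *\<^sub>R B 0" by blast
        then show ?thesis by simp
      qed
      ultimately have "x \<bullet> x = 0" using E unfolding is_form_domain_def by (metis add_0 inner_zero_left)
      then show ?thesis by simp
    qed
    show "\<iota> x \<bullet> \<iota> (e i) = (x \<bullet> e i) / (1 + ev (Suc i))" for x i
      using s(1)[of i] unfolding inner_e \<iota>_e s(2)[symmetric] by simp
    show "0 \<le> ev (Suc i)" for i by (rule ev)
    show "filterlim (\<lambda>i. ev (Suc i)) at_top sequentially"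
      using basis by (simp add: eigenbasis_def filterlim_sequentially_Suc)
  qed
  then show ?thesis using that \<iota>_e by (simp add: s_def)
qed

theorem theorem1p8:
  fixes D DB :: "'h::{real_inner, banach} set"
    and A B :: "'h \<Rightarrow> 'h"
    and \<iota> :: "'e::{real_inner, banach} \<Rightarrow> 'h"
    and I :: "'e \<Rightarrow> real"
    and ev :: "nat \<Rightarrow> real"
    and \<zeta> :: "nat \<Rightarrow> 'h"
    and n :: nat
  assumes H_infinite_dim: "\<And>S :: 'h set. finite S \<Longrightarrow> span S \<noteq> UNIV"
    and H_separable: "separable_space (euclidean :: 'h topology)"
    and A_self_adjoint: "self_adjoint_operator D A"
    and A_nonnegative: "nonnegative_operator D A"
    and A_compact_resolvent: "has_compact_resolvent D A"
    and B_sqrt: "is_operator_sqrt D A DB B"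
    and E_space: "is_form_domain DB B \<iota>"
    and basis: "eigenbasis D A ev \<zeta>"
    and I_C1: "C1_functional I"
    and I_zero: "I 0 = 0"
    and I_deriv_zero: "\<And>v. dfun I 0 v = 0"
    and I_weak: "\<And>x u. weakly_converges x u \<Longrightarrow> (\<lambda>k. I (x k)) \<longlonglongrightarrow> I u"
    and I_pos: "\<And>u. u \<noteq> 0 \<Longrightarrow> 0 < I u"
    and I_mono: "\<And>u. u \<noteq> 0 \<Longrightarrow> mono_on {0<..} (\<lambda>t. I (t *\<^sub>R u) / t\<^sup>2)"
    and I_at_0: "\<And>u. u \<noteq> 0 \<Longrightarrow> ((\<lambda>t. I (t *\<^sub>R u) / t\<^sup>2) \<longlongrightarrow> 0) (at_right 0)"
    and I_at_top: "\<And>u. u \<noteq> 0 \<Longrightarrow> filterlim (\<lambda>t. I (t *\<^sub>R u) / t\<^sup>2) at_top at_top"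
    and I_ineq: "\<And>u v s. u \<noteq> 0 \<Longrightarrow> s \<ge> -1 \<Longrightarrow>
        I u - I ((1 + s) *\<^sub>R u + v) + dfun I u ((s * (s / 2 + 1)) *\<^sub>R u + (1 + s) *\<^sub>R v) \<le> 0"
    and I_ineq_strict: "\<And>u s. u \<noteq> 0 \<Longrightarrow> s \<ge> -1 \<Longrightarrow> s \<noteq> 0 \<Longrightarrow>
        I u - I ((1 + s) *\<^sub>R u) + dfun I u ((s * (s / 2 + 1)) *\<^sub>R u) < 0"
    and n_ge_1: "n \<ge> 1"
    and gap: "ev n < ev (n + 1)"
  shows "\<exists>g>0. {0<..<g} \<subseteq> M_set B \<iota> I ev \<zeta> n \<and> M_set B \<iota> I ev \<zeta> n \<subseteq> {0<..g}"
proof -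
  obtain e where cf: "compact_form e \<iota> (\<lambda>i. ev (Suc i))"
    and \<iota>_e: "\<And>i. \<iota> (e i) = (1 / sqrt (1 + ev (Suc i))) *\<^sub>R \<zeta> (Suc i)"
    using form_domain_eigenbasis[OF B_sqrt E_space basis] by blast
  interpret compact_form e \<iota> "\<lambda>i. ev (Suc i)" by (rule cf)
  have mono: "ev i \<le> ev j" if "1 \<le> i" "i \<le> j" for i j
    using basis that by (auto simp: eigenbasis_def elim!: mono_onD)
  interpret nehari_pankov e \<iota> "\<lambda>i. ev (Suc i)" I n "ev n" "ev (n + 1)"
  proof
    show "I differentiable (at u)" for u
      using I_C1 unfolding C1_functional_def differentiable_def by blast
    show "ev (Suc i) \<le> ev n" if "i < n" for i using mono[of "Suc i" n] that by simp
    show "ev (n + 1) \<le> ev (Suc i)" if "n \<le> i" for i using mono[of "n + 1" "Suc i"] that by simp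
    show "0 \<le> ev n" using ev_nonneg[of "n - 1"] n_ge_1 by simp
  qed (fact I_zero I_weak I_pos I_mono I_at_0 I_at_top I_ineq I_ineq_strict gap | simp)+
  have V: "E_sub \<iota> \<zeta> n = V"
  proof
    have "\<zeta> k \<in> \<iota> ` V" if "k \<in> {1..n}" for k
    proof -
      from that obtain i where i: "k = Suc i" "i < n" by (cases k) auto
      let ?y = "sqrt (1 + ev (Suc i)) *\<^sub>R e i"
      have "1 + ev (Suc i) > 0" using ev_nonneg[of i] by simp
      then have "\<zeta> k = \<iota> ?y" by (simp add: i \<iota>.scaleR \<iota>_e)
      moreover have "?y \<in> V" unfolding V_def using i by (intro span_scale span_base) auto
      ultimately show ?thesis by blast
    qed
    then have sub: "span (\<zeta> ` {1..n}) \<subseteq> \<iota> ` V"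
      using linear_subspace_image[OF \<iota>.linear subspace_V] by (intro span_minimal) auto
    show "E_sub \<iota> \<zeta> n \<subseteq> V"
    proof
      fix u assume "u \<in> E_sub \<iota> \<zeta> n"
      then obtain v where v: "v \<in> V" "\<iota> u = \<iota> v" using sub by (auto simp: E_sub_def)
      then have "u - v = 0" using mass_pos[of "u - v"] by (auto simp: mass_def \<iota>.diff)
      then show "u \<in> V" using v by simp
    qed
    have "subspace {u. \<iota> u \<in> span (\<zeta> ` {1..n})}"
      by (auto simp: subspace_def \<iota>.zero \<iota>.add \<iota>.scaleR span_zero span_add span_scale)
    moreover have "\<iota> (e i) \<in> span (\<zeta> ` {1..n})" if "i < n" for i
      unfolding \<iota>_e using that by (intro span_scale span_base) auto
    ultimately show "V \<subseteq> E_sub \<iota> \<zeta> n"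
      unfolding V_def E_sub_def by (intro span_minimal) auto
  qed
  have J: "J_fun B \<iota> I l = J l" for l
  proof
    fix u
    have "u \<bullet> u = \<iota> u \<bullet> \<iota> u + B (\<iota> u) \<bullet> B (\<iota> u)" using E_space by (simp add: is_form_domain_def)
    then show "J_fun B \<iota> I l u = J l u"
      by (simp add: J_fun_def q_form_def J_def q_def algebra_simps)
  qed
  have NP: "NP_set B \<iota> I \<zeta> n l = NP l" for l
    by (simp add: NP_set_def NP_def F_sub_def V J)
  have "M_set B \<iota> I ev \<zeta> n = {mass u | u l. ground_state l u}"
    unfolding M_set_def Q_set_def c_level_def NP J ground_state_def mass_def c_def by blast
  then show ?thesis using masses_fill_interval by simp
qed

end
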